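(* Let $\mathcal{M}$ be an rc 0-cell in a 2-category $\mathcal{A}$, let $p:\mathcal{A}_{/_l\mathcal{M}}\to\mathcal{A}$ be the domain 2-functor from the lax slice, and let $(\mathcal{R}=Ur,\eta,\mu)$ be the monad on a 0-cell $\mathcal{C}$ given by an adjunction $(r\dashv U,\eta,\varepsilon):\mathcal{C}\to\mathcal{M}$ in $\mathcal{A}$, admitting a Kleisli object and an Eilenberg–Moore object in $\mathcal{A}$. Then $p$ creates the kem-diagram for $\mathcal{R}$; that is, the (unique) lift of the kem-diagram of the monad $(\mathcal{R},\eta,\mu)$ in $\mathcal{A}$, consisting of the 0-cells $(\mathcal{C}_{\mathcal{R}},\dot r)$, $(\mathcal{C},r)$, $(\mathcal{C}^{\mathcal{R}},\ddot r)$ and the 1-cells $(F_{\mathcal{R}},id)$, $(U_{\mathcal{R}},\dot u)$, $(F^{\mathcal{R}},\ddot v)$, $(U^{\mathcal{R}},\ddot u)$, is a kem-diagram for the monad $(\mathcal{R},\varepsilon_r)$ (with unit $\eta$ and multiplication $\mu$) on $(\mathcal{C},r)$ in $\mathcal{A}_{/_l\mathcal{M}}$, where: 1. $\dot r:\mathcal{C}_{\mathcal{R}}\to\mathcal{M}$ is the 1-cell from the Kleisli object $(\mathcal{C}_{\mathcal{R}},F_{\mathcal{R}},U_{\mathcal{R}})$ existing by its couniversal property (determined by $\dot rF_{\mathcal{R}}=r$ and $\dot r(\kappa)=\varepsilon_r$); 2. $\dot u=\dot r(\varepsilon_{\mathcal{R}}):rU_{\mathcal{R}}=\dot rF_{\mathcal{R}}U_{\mathcal{R}}\to\dot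 r$; 3. $\ddot r:\mathcal{C}^{\mathcal{R}}\to\mathcal{M}$ is a left adjoint to the comparison 1-cell $K:\mathcal{M}\to\mathcal{C}^{\mathcal{R}}$ such that $\ddot rF^{\mathcal{R}}=r$; 4. $\ddot u=\ddot r(\varepsilon^{\mathcal{R}}):rU^{\mathcal{R}}=\ddot rF^{\mathcal{R}}U^{\mathcal{R}}\to\ddot r$.
   Context: rc 0-cell: a 0-cell $\mathcal{M}$ such that every category $\mathcal{A}(\mathcal{X},\mathcal{M})$ has reflexive coequalizers and every precomposition functor $\mathcal{A}(\mathcal{X},\mathcal{M})\to\mathcal{A}(\mathcal{Y},\mathcal{M})$ preserves them. Lax slice $\mathcal{A}_{/_l\mathcal{M}}$: 0-cells are 1-cells $b:B\to\mathcal{M}$ of $\mathcal{A}$, written $(B,b)$; a 1-cell $(F,\theta):(B,b)\to(C,c)$ is a 1-cell $F:B\to C$ with a 2-cell $\theta:cF\to b$; a 2-cell $\tau:(F,\theta)\to(F',\theta')$ is a 2-cell $\tau:F\to F'$ with $\theta'\circ c(\tau)=\theta$. Composition of 1-cells: for $(F,\theta):(B,b)\to(C,c)$ and $(G,\gamma):(C,c)\to(D,d)$, $(G,\gamma)\circ(F,\theta)=(GF,\theta\circ\gamma_F)$. For a monad $(\mathcal{C},\mathcal{R},\eta,\mu)$ in a 2-category: a subequalizing on $\mathcal{X}$ is a 1-cell $u:\mathcal{X}\to\mathcal{C}$ with $\nu:\mathcal{R}u\to u$, $\nu\circ\eta_u=1$, $\nu\circ\mathcal{R}(\nu)=\nu\circ\mu_u$;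 a subcoequalizing is a 1-cell $u:\mathcal{C}\to\mathcal{X}$ with $\nu:u\mathcal{R}\to u$, $\nu\circ u(\eta)=1$, $\nu\circ\nu_{\mathcal{R}}=\nu\circ u(\mu)$. Morphisms are 2-cells between the $u$'s commuting with the $\nu$'s. The Eilenberg–Moore object $(\mathcal{C}^{\mathcal{R}},U^{\mathcal{R}},\beta)$ is the universal subequalizing and the Kleisli object $(\mathcal{C}_{\mathcal{R}},F_{\mathcal{R}},\kappa)$ the couniversal subcoequalizing (inducing natural isomorphisms of the categories of subequalizings on $\mathcal{X}$ and subcoequalizings on $\mathcal{X}$ with $\mathcal{A}(\mathcal{X},\mathcal{C}^{\mathcal{R}})$ and $\mathcal{A}(\mathcal{C}_{\mathcal{R}},\mathcal{X})$, respectively). They come with adjunctions $(F^{\mathcal{R}}\dashv U^{\mathcal{R}},\eta,\varepsilon^{\mathcal{R}})$, where $U^{\mathcal{R}}F^{\mathcal{R}}=\mathcal{R}$, $\beta_{F^{\mathcal{R}}}=\mu$, $U^{\mathcal{R}}(\varepsilon^{\mathcal{R}})=\beta$, and $(F_{\mathcal{R}}\dashv U_{\mathcal{R}},\eta,\varepsilon_{\mathcal{R}})$, where $U_{\mathcal{R}}F_{\mathcal{R}}=\mathcal{R}$, $U_{\mathcal{R}}(\kappa)=\mu$, $(\varepsilon_{\mathcal{R}})_{F_{\mathcal{R}}}=\kappa$. The kem-diagram of the monad consists of the monad, the Kleisli and Eilenberg–Moore objects, these two adjunctions and the comparison 1-cell $\mathcal{C}_{\mathcal{R}}\to\mathcal{C}^{\mathcal{R}}$.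 The comparison $K:\mathcal{M}\to\mathcal{C}^{\mathcal{R}}$ is the 1-cell determined by $U^{\mathcal{R}}K=U$ and $\beta_K=U(\varepsilon)$. A left adjoint $\ddot r$ of $K$ is given by the reflexive coequalizer $q:rU^{\mathcal{R}}\to\ddot r$ of the pair $rU^{\mathcal{R}}(\varepsilon^{\mathcal{R}}),\ \varepsilon_{rU^{\mathcal{R}}}:r\mathcal{R}U^{\mathcal{R}}\to rU^{\mathcal{R}}$ in $\mathcal{A}(\mathcal{C}^{\mathcal{R}},\mathcal{M})$. The 2-cell $\ddot v:\ddot rF^{\mathcal{R}}\to r$ is the comparison with $\ddot v\circ q_{F^{\mathcal{R}}}=\varepsilon_r$.
   Formalization: The equality r̈F^R = r, which can fail strictly, is read as the invertible comparison v̈ : r̈F^R → r with v̈∘q_F = ε_r, so ü = r̈(ε^R)∘(v̈⁻¹)_{U^R}; the lift is unique up to a unique isomorphism over the identity rather than strictly unique. *)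

theory Defs
  imports Main
begin

section \<open>Strict 2-categories\<close>

text \<open>
  A 2-category is given by its 0-cells, the hom-sets of 1-cells \<open>Hom1 A X Y\<close> and of 2-cells
  \<open>Hom2 A X Y f g\<close> (for 1-cells \<open>f\<close>, \<open>g\<close> from \<open>X\<close> to \<open>Y\<close>), and the operations.
  As in the enriched presentation, hom-sets need not be disjoint, so that the cells of the
  lax slice below can be the pairs \<open>(B, b)\<close>, \<open>(F, \<theta>)\<close> and the bare 2-cells \<open>\<tau>\<close>.
  Every 2-category with source and target maps is an instance.
\<close>

record ('o, 'm, 'c) two_cat =
  Obj :: "'o set"
  Hom1 :: "'o \<Rightarrow> 'o \<Rightarrow> 'm set"
  Hom2 :: "'o \<Rightarrow> 'o \<Rightarrow> 'm \<Rightarrow> 'm \<Rightarrow> 'c set"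
  Id1 :: "'o \<Rightarrow> 'm"
  Comp1 :: "'m \<Rightarrow> 'm \<Rightarrow> 'm" (infixr "\<odot>\<index>" 75)
  Id2 :: "'m \<Rightarrow> 'c"
  VComp :: "'c \<Rightarrow> 'c \<Rightarrow> 'c" (infixr "\<bullet>\<index>" 65)
  HComp :: "'c \<Rightarrow> 'c \<Rightarrow> 'c" (infixr "\<star>\<index>" 70)

locale two_category =
  fixes A :: "('o, 'm, 'c) two_cat" (structure)
  assumes Hom1_Obj: "f \<in> Hom1 A X Y \<Longrightarrow> X \<in> Obj A \<and> Y \<in> Obj A"
    and Hom2_Hom1: "\<alpha> \<in> Hom2 A X Y f g \<Longrightarrow> f \<in> Hom1 A X Y \<and> g \<in> Hom1 A X Y"
    and Id1_in: "X \<in> Obj A \<Longrightarrow> Id1 A X \<in> Hom1 A X X"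
    and Comp1_in: "\<lbrakk>f \<in> Hom1 A X Y; g \<in> Hom1 A Y Z\<rbrakk> \<Longrightarrow> g \<odot> f \<in> Hom1 A X Z"
    and Comp1_assoc: "\<lbrakk>f \<in> Hom1 A W X; g \<in> Hom1 A X Y; h \<in> Hom1 A Y Z\<rbrakk>
        \<Longrightarrow> (h \<odot> g) \<odot> f = h \<odot> (g \<odot> f)"
    and Comp1_Id_left: "f \<in> Hom1 A X Y \<Longrightarrow> Id1 A Y \<odot> f = f"
    and Comp1_Id_right: "f \<in> Hom1 A X Y \<Longrightarrow> f \<odot> Id1 A X = f"
    and Id2_in: "f \<in> Hom1 A X Y \<Longrightarrow> Id2 A f \<in> Hom2 A X Y f f"
    and VComp_in: "\<lbrakk>\<alpha> \<in> Hom2 A X Y f g; \<beta> \<in> Hom2 A X Y g h\<rbrakk> \<Longrightarrow> \<beta> \<bullet> \<alpha> \<in> Hom2 A X Y f h"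
    and VComp_assoc: "\<lbrakk>\<alpha> \<in> Hom2 A X Y f g; \<beta> \<in> Hom2 A X Y g h; \<gamma> \<in> Hom2 A X Y h k\<rbrakk>
        \<Longrightarrow> (\<gamma> \<bullet> \<beta>) \<bullet> \<alpha> = \<gamma> \<bullet> (\<beta> \<bullet> \<alpha>)"
    and VComp_Id_left: "\<alpha> \<in> Hom2 A X Y f g \<Longrightarrow> Id2 A g \<bullet> \<alpha> = \<alpha>"
    and VComp_Id_right: "\<alpha> \<in> Hom2 A X Y f g \<Longrightarrow> \<alpha> \<bullet> Id2 A f = \<alpha>"
    and HComp_in: "\<lbrakk>\<alpha> \<in> Hom2 A X Y f f'; \<beta> \<in> Hom2 A Y Z g g'\<rbrakk>
        \<Longrightarrow> \<beta> \<star> \<alpha> \<in> Hom2 A X Z (g \<odot> f) (g' \<odot> f')"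
    and HComp_assoc: "\<lbrakk>\<alpha> \<in> Hom2 A W X f f'; \<beta> \<in> Hom2 A X Y g g'; \<gamma> \<in> Hom2 A Y Z h h'\<rbrakk>
        \<Longrightarrow> (\<gamma> \<star> \<beta>) \<star> \<alpha> = \<gamma> \<star> (\<beta> \<star> \<alpha>)"
    and HComp_Id_left: "\<alpha> \<in> Hom2 A X Y f g \<Longrightarrow> Id2 A (Id1 A Y) \<star> \<alpha> = \<alpha>"
    and HComp_Id_right: "\<alpha> \<in> Hom2 A X Y f g \<Longrightarrow> \<alpha> \<star> Id2 A (Id1 A X) = \<alpha>"
    and HComp_Id2: "\<lbrakk>f \<in> Hom1 A X Y; g \<in> Hom1 A Y Z\<rbrakk> \<Longrightarrow> Id2 A g \<star> Id2 A f = Id2 A (g \<odot> f)"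
    and interchange: "\<lbrakk>\<alpha> \<in> Hom2 A X Y f f'; \<alpha>' \<in> Hom2 A X Y f' f'';
          \<beta> \<in> Hom2 A Y Z g g'; \<beta>' \<in> Hom2 A Y Z g' g''\<rbrakk>
        \<Longrightarrow> (\<beta>' \<bullet> \<beta>) \<star> (\<alpha>' \<bullet> \<alpha>) = (\<beta>' \<star> \<alpha>') \<bullet> (\<beta> \<star> \<alpha>)"

text \<open>The whiskerings \<open>g \<rhd> \<tau>\<close> and \<open>\<tau> \<lhd> f\<close> are the 2-cells usually written $g(\tau)$ and $\tau_f$.\<close>

definition lwhisk :: "('o, 'm, 'c) two_cat \<Rightarrow> 'm \<Rightarrow> 'c \<Rightarrow> 'c" (infix "\<rhd>\<index>" 70)
  where "g \<rhd>\<^bsub>A\<^esub> \<tau> = Id2 A g \<star>\<^bsub>A\<^esub> \<tau>"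

definition rwhisk :: "('o, 'm, 'c) two_cat \<Rightarrow> 'c \<Rightarrow> 'm \<Rightarrow> 'c" (infix "\<lhd>\<index>" 70)
  where "\<tau> \<lhd>\<^bsub>A\<^esub> f = \<tau> \<star>\<^bsub>A\<^esub> Id2 A f"

definition inverse_2cells ::
    "('o, 'm, 'c) two_cat \<Rightarrow> 'o \<Rightarrow> 'o \<Rightarrow> 'm \<Rightarrow> 'm \<Rightarrow> 'c \<Rightarrow> 'c \<Rightarrow> bool"
  where "inverse_2cells A X Y f g \<alpha> \<beta> \<longleftrightarrow>
    \<alpha> \<in> Hom2 A X Y f g \<and> \<beta> \<in> Hom2 A X Y g f \<and> \<beta> \<bullet> \<alpha> = Id2 A f \<and> \<alpha> \<bullet> \<beta> = Id2 A g"
  for A (structure)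

definition iso_1cell :: "('o, 'm, 'c) two_cat \<Rightarrow> 'o \<Rightarrow> 'o \<Rightarrow> 'm \<Rightarrow> bool"
  where "iso_1cell A X Y h \<longleftrightarrow>
    h \<in> Hom1 A X Y \<and> (\<exists>k \<in> Hom1 A Y X. k \<odot> h = Id1 A X \<and> h \<odot> k = Id1 A Y)"
  for A (structure)

definition adjunction ::
    "('o, 'm, 'c) two_cat \<Rightarrow> 'o \<Rightarrow> 'o \<Rightarrow> 'm \<Rightarrow> 'm \<Rightarrow> 'c \<Rightarrow> 'c \<Rightarrow> bool"
  where "adjunction A X Y l u \<eta> \<epsilon> \<longleftrightarrow>
    l \<in> Hom1 A X Y \<and> u \<in> Hom1 A Y X \<and>
    \<eta> \<in> Hom2 A X X (Id1 A X) (u \<odot> l) \<and> \<epsilon> \<in> Hom2 A Y Y (l \<odot> u) (Id1 A Y) \<and>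
    (\<epsilon> \<lhd> l) \<bullet> (l \<rhd> \<eta>) = Id2 A l \<and> (u \<rhd> \<epsilon>) \<bullet> (\<eta> \<lhd> u) = Id2 A u"
  for A (structure)

definition two_functor ::
    "('o, 'm, 'c) two_cat \<Rightarrow> ('p, 'n, 'd) two_cat \<Rightarrow> ('o \<Rightarrow> 'p) \<Rightarrow> ('m \<Rightarrow> 'n) \<Rightarrow> ('c \<Rightarrow> 'd) \<Rightarrow> bool"
  where "two_functor S T p0 p1 p2 \<longleftrightarrow>
    (\<forall>X \<in> Obj S. p0 X \<in> Obj T \<and> p1 (Id1 S X) = Id1 T (p0 X)) \<and>
    (\<forall>X Y. \<forall>f \<in> Hom1 S X Y. p1 f \<in> Hom1 T (p0 X) (p0 Y) \<and> p2 (Id2 S f) = Id2 T (p1 f)) \<and>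
    (\<forall>X Y f g. \<forall>\<alpha> \<in> Hom2 S X Y f g. p2 \<alpha> \<in> Hom2 T (p0 X) (p0 Y) (p1 f) (p1 g)) \<and>
    (\<forall>X Y Z. \<forall>f \<in> Hom1 S X Y. \<forall>g \<in> Hom1 S Y Z. p1 (g \<odot>\<^bsub>S\<^esub> f) = p1 g \<odot>\<^bsub>T\<^esub> p1 f) \<and>
    (\<forall>X Y f g h. \<forall>\<alpha> \<in> Hom2 S X Y f g. \<forall>\<beta> \<in> Hom2 S X Y g h.
        p2 (\<beta> \<bullet>\<^bsub>S\<^esub> \<alpha>) = p2 \<beta> \<bullet>\<^bsub>T\<^esub> p2 \<alpha>) \<and>
    (\<forall>X Y Z f f' g g'. \<forall>\<alpha> \<in> Hom2 S X Y f f'. \<forall>\<beta> \<in> Hom2 S Y Z g g'.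
        p2 (\<beta> \<star>\<^bsub>S\<^esub> \<alpha>) = p2 \<beta> \<star>\<^bsub>T\<^esub> p2 \<alpha>)"


section \<open>Reflexive coequalizers and rc 0-cells\<close>

definition reflexive_pair ::
    "('o, 'm, 'c) two_cat \<Rightarrow> 'o \<Rightarrow> 'o \<Rightarrow> 'm \<Rightarrow> 'm \<Rightarrow> 'c \<Rightarrow> 'c \<Rightarrow> bool"
  where "reflexive_pair A X Y a b f g \<longleftrightarrow>
    f \<in> Hom2 A X Y a b \<and> g \<in> Hom2 A X Y a b \<and>
    (\<exists>s \<in> Hom2 A X Y b a. f \<bullet> s = Id2 A b \<and> g \<bullet> s = Id2 A b)"
  for A (structure)

definition is_coequalizer ::
    "('o, 'm, 'c) two_cat \<Rightarrow> 'o \<Rightarrow> 'o \<Rightarrow> 'm \<Rightarrow> 'm \<Rightarrow> 'c \<Rightarrow> 'c \<Rightarrow> 'm \<Rightarrow> 'c \<Rightarrow> bool"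
  where "is_coequalizer A X Y a b f g c q \<longleftrightarrow>
    f \<in> Hom2 A X Y a b \<and> g \<in> Hom2 A X Y a b \<and> q \<in> Hom2 A X Y b c \<and> q \<bullet> f = q \<bullet> g \<and>
    (\<forall>d. \<forall>h \<in> Hom2 A X Y b d. h \<bullet> f = h \<bullet> g \<longrightarrow> (\<exists>!k. k \<in> Hom2 A X Y c d \<and> k \<bullet> q = h))"
  for A (structure)

definition rc_0cell :: "('o, 'm, 'c) two_cat \<Rightarrow> 'o \<Rightarrow> bool"
  where "rc_0cell A M \<longleftrightarrow> M \<in> Obj A \<and>
    (\<forall>X \<in> Obj A. \<forall>a b f g. reflexive_pair A X M a b f g \<longrightarrow>
        (\<exists>c q. is_coequalizer A X M a b f g c q)) \<and>
    (\<forall>X \<in> Obj A. \<forall>Y \<in> Obj A. \<forall>h \<in> Hom1 A Y X. \<forall>a b f g c q.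
        reflexive_pair A X M a b f g \<and> is_coequalizer A X M a b f g c q \<longrightarrow>
        is_coequalizer A Y M (a \<odot> h) (b \<odot> h) (f \<lhd> h) (g \<lhd> h) (c \<odot> h) (q \<lhd> h))"
  for A (structure)


section \<open>Monads, Eilenberg--Moore and Kleisli objects\<close>

record ('o, 'm, 'c) monad_data =
  Base :: 'o
  Endo :: 'm
  MUnit :: 'c
  Mult :: 'c

definition is_monad :: "('o, 'm, 'c) two_cat \<Rightarrow> ('o, 'm, 'c) monad_data \<Rightarrow> bool"
  where "is_monad A N \<longleftrightarrow> (let C = Base N; R = Endo N; \<eta> = MUnit N; \<mu> = Mult N in
    C \<in> Obj A \<and> R \<in> Hom1 A C C \<and>
    \<eta> \<in> Hom2 A C C (Id1 A C) R \<and> \<mu> \<in> Hom2 A C C (R \<odot> R) R \<and>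
    \<mu> \<bullet> (R \<rhd> \<mu>) = \<mu> \<bullet> (\<mu> \<lhd> R) \<and> \<mu> \<bullet> (R \<rhd> \<eta>) = Id2 A R \<and> \<mu> \<bullet> (\<eta> \<lhd> R) = Id2 A R)"
  for A (structure)

definition Subeq :: "('o, 'm, 'c) two_cat \<Rightarrow> ('o, 'm, 'c) monad_data \<Rightarrow> 'o \<Rightarrow> ('m \<times> 'c) set"
  where "Subeq A N X = {(u, \<nu>). u \<in> Hom1 A X (Base N) \<and> \<nu> \<in> Hom2 A X (Base N) (Endo N \<odot> u) u \<and>
    \<nu> \<bullet> (MUnit N \<lhd> u) = Id2 A u \<and> \<nu> \<bullet> (Endo N \<rhd> \<nu>) = \<nu> \<bullet> (Mult N \<lhd> u)}"
  for A (structure)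

definition Subeq_mor ::
    "('o, 'm, 'c) two_cat \<Rightarrow> ('o, 'm, 'c) monad_data \<Rightarrow> 'o \<Rightarrow> 'm \<times> 'c \<Rightarrow> 'm \<times> 'c \<Rightarrow> 'c set"
  where "Subeq_mor A N X s t = {\<sigma> \<in> Hom2 A X (Base N) (fst s) (fst t).
    \<sigma> \<bullet> snd s = snd t \<bullet> (Endo N \<rhd> \<sigma>)}"
  for A (structure)

definition Subcoeq :: "('o, 'm, 'c) two_cat \<Rightarrow> ('o, 'm, 'c) monad_data \<Rightarrow> 'o \<Rightarrow> ('m \<times> 'c) set"
  where "Subcoeq A N X = {(u, \<nu>). u \<in> Hom1 A (Base N) X \<and> \<nu> \<in> Hom2 A (Base N) X (u \<odot> Endo N) u \<and>
    \<nu> \<bullet> (u \<rhd> MUnit N) = Id2 A u \<and> \<nu> \<bullet> (\<nu> \<lhd> Endo N) = \<nu> \<bullet> (u \<rhd> Mult N)}"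
  for A (structure)

definition Subcoeq_mor ::
    "('o, 'm, 'c) two_cat \<Rightarrow> ('o, 'm, 'c) monad_data \<Rightarrow> 'o \<Rightarrow> 'm \<times> 'c \<Rightarrow> 'm \<times> 'c \<Rightarrow> 'c set"
  where "Subcoeq_mor A N X s t = {\<sigma> \<in> Hom2 A (Base N) X (fst s) (fst t).
    \<sigma> \<bullet> snd s = snd t \<bullet> (\<sigma> \<lhd> Endo N)}"
  for A (structure)

text \<open>
  (Co)universality asserts that the functors induced by the given sub(co)equalizing from the
  hom-categories to the categories of sub(co)equalizings are isomorphisms of categories,
  i.e. bijective on objects and on each set of morphisms.
\<close>

definition em_object ::
    "('o, 'm, 'c) two_cat \<Rightarrow> ('o, 'm, 'c) monad_data \<Rightarrow> 'o \<Rightarrow> 'm \<Rightarrow> 'c \<Rightarrow> bool"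
  where "em_object A N E u \<beta> \<longleftrightarrow> E \<in> Obj A \<and> (u, \<beta>) \<in> Subeq A N E \<and>
    (\<forall>X \<in> Obj A. bij_betw (\<lambda>k. (u \<odot> k, \<beta> \<lhd> k)) (Hom1 A X E) (Subeq A N X) \<and>
      (\<forall>k \<in> Hom1 A X E. \<forall>k' \<in> Hom1 A X E. bij_betw (\<lambda>\<tau>. u \<rhd> \<tau>) (Hom2 A X E k k')
          (Subeq_mor A N X (u \<odot> k, \<beta> \<lhd> k) (u \<odot> k', \<beta> \<lhd> k'))))"
  for A (structure)

definition kleisli_object ::
    "('o, 'm, 'c) two_cat \<Rightarrow> ('o, 'm, 'c) monad_data \<Rightarrow> 'o \<Rightarrow> 'm \<Rightarrow> 'c \<Rightarrow> bool"
  where "kleisli_object A N L f \<kappa> \<longleftrightarrow> L \<in> Obj A \<and> (f, \<kappa>) \<in> Subcoeq A N L \<and>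
    (\<forall>X \<in> Obj A. bij_betw (\<lambda>k. (k \<odot> f, k \<rhd> \<kappa>)) (Hom1 A L X) (Subcoeq A N X) \<and>
      (\<forall>k \<in> Hom1 A L X. \<forall>k' \<in> Hom1 A L X. bij_betw (\<lambda>\<tau>. \<tau> \<lhd> f) (Hom2 A L X k k')
          (Subcoeq_mor A N X (k \<odot> f, k \<rhd> \<kappa>) (k' \<odot> f, k' \<rhd> \<kappa>))))"
  for A (structure)

text \<open>
  \<open>comparison A E u\<^sub>E \<beta> X u \<epsilon> k\<close>: \<open>k\<close> is the comparison 1-cell, from the codomain \<open>X\<close> of the left
  adjoint of an adjunction with right adjoint \<open>u\<close> and counit \<open>\<epsilon>\<close>, to the Eilenberg--Moore object
  \<open>(E, u\<^sub>E, \<beta>)\<close> of the induced monad.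
\<close>

definition comparison ::
    "('o, 'm, 'c) two_cat \<Rightarrow> 'o \<Rightarrow> 'm \<Rightarrow> 'c \<Rightarrow> 'o \<Rightarrow> 'm \<Rightarrow> 'c \<Rightarrow> 'm \<Rightarrow> bool"
  where "comparison A E u\<^sub>E \<beta> X u \<epsilon> k \<longleftrightarrow>
    k \<in> Hom1 A X E \<and> u\<^sub>E \<odot> k = u \<and> \<beta> \<lhd> k = u \<rhd> \<epsilon>"
  for A (structure)


section \<open>Kem-diagrams\<close>

record ('o, 'm, 'c) kem_data = "('o, 'm, 'c) monad_data" +
  Kl :: 'o
  KlF :: 'm
  KlU :: 'm
  Kappa :: 'c
  KlCounit :: 'c
  EM :: 'o
  EMF :: 'm
  EMU :: 'm
  Beta :: 'c
  EMCounit :: 'c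
  Cmp :: 'm

abbreviation monad_of :: "('o, 'm, 'c) kem_data \<Rightarrow> ('o, 'm, 'c) monad_data"
  where "monad_of D \<equiv> monad_data.truncate D"

definition kem_diagram :: "('o, 'm, 'c) two_cat \<Rightarrow> ('o, 'm, 'c) kem_data \<Rightarrow> bool"
  where "kem_diagram A D \<longleftrightarrow>
    is_monad A (monad_of D) \<and>
    kleisli_object A (monad_of D) (Kl D) (KlF D) (Kappa D) \<and>
    em_object A (monad_of D) (EM D) (EMU D) (Beta D) \<and>
    adjunction A (Base D) (Kl D) (KlF D) (KlU D) (MUnit D) (KlCounit D) \<and>
    KlU D \<odot> KlF D = Endo D \<and> KlU D \<rhd> Kappa D = Mult D \<and> KlCounit D \<lhd> KlF D = Kappa D \<and>
    adjunction A (Base D) (EM D) (EMF D) (EMU D) (MUnit D) (EMCounit D) \<and>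
    EMU D \<odot> EMF D = Endo D \<and> Beta D \<lhd> EMF D = Mult D \<and> EMU D \<rhd> EMCounit D = Beta D \<and>
    comparison A (EM D) (EMU D) (Beta D) (Kl D) (KlU D) (KlCounit D) (Cmp D)"
  for A (structure)

definition map_kem ::
    "('o \<Rightarrow> 'p) \<Rightarrow> ('m \<Rightarrow> 'n) \<Rightarrow> ('c \<Rightarrow> 'd) \<Rightarrow> ('o, 'm, 'c) kem_data \<Rightarrow> ('p, 'n, 'd) kem_data"
  where "map_kem p0 p1 p2 D =
    \<lparr>Base = p0 (Base D), Endo = p1 (Endo D), MUnit = p2 (MUnit D), Mult = p2 (Mult D),
     Kl = p0 (Kl D), KlF = p1 (KlF D), KlU = p1 (KlU D),
     Kappa = p2 (Kappa D), KlCounit = p2 (KlCounit D),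
     EM = p0 (EM D), EMF = p1 (EMF D), EMU = p1 (EMU D),
     Beta = p2 (Beta D), EMCounit = p2 (EMCounit D),
     Cmp = p1 (Cmp D)\<rparr>"

text \<open>Isomorphisms of kem-diagrams of the same monad, being the identity on that monad.\<close>

definition kem_iso ::
    "('o, 'm, 'c) two_cat \<Rightarrow> ('o, 'm, 'c) kem_data \<Rightarrow> ('o, 'm, 'c) kem_data \<Rightarrow> 'm \<Rightarrow> 'm \<Rightarrow> bool"
  where "kem_iso A D D' h g \<longleftrightarrow>
    iso_1cell A (Kl D) (Kl D') h \<and> iso_1cell A (EM D) (EM D') g \<and>
    h \<odot> KlF D = KlF D' \<and> KlU D' \<odot> h = KlU D \<and>
    h \<rhd> Kappa D = Kappa D' \<and> h \<rhd> KlCounit D = KlCounit D' \<lhd> h \<and>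
    g \<odot> EMF D = EMF D' \<and> EMU D' \<odot> g = EMU D \<and>
    Beta D' \<lhd> g = Beta D \<and> g \<rhd> EMCounit D = EMCounit D' \<lhd> g \<and>
    g \<odot> Cmp D = Cmp D' \<odot> h"
  for A (structure)

text \<open>
  The 2-functor \<open>(p0, p1, p2) : S \<rightarrow> T\<close> creates the kem-diagram \<open>D\<close> for the monad \<open>N\<close> in \<open>S\<close>, with
  lift \<open>L\<close>: the diagram \<open>L\<close> lies over \<open>D\<close>, is a kem-diagram for \<open>N\<close>, and is the only such one
  up to a unique isomorphism lying over the identity. (For a lax slice, replacing the leg
  of a lifted 0-cell by an isomorphic leg gives another lift with the same universal
  properties, so uniqueness on the nose is not available.)
\<close>

definition creates_kem ::
    "('o, 'm, 'c) two_cat \<Rightarrow> ('p, 'n, 'd) two_cat \<Rightarrow> ('o \<Rightarrow> 'p) \<Rightarrow> ('m \<Rightarrow> 'n) \<Rightarrow> ('c \<Rightarrow> 'd) \<Rightarrow>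
     ('o, 'm, 'c) monad_data \<Rightarrow> ('p, 'n, 'd) kem_data \<Rightarrow> ('o, 'm, 'c) kem_data \<Rightarrow> bool"
  where "creates_kem S T p0 p1 p2 N D L \<longleftrightarrow>
    two_functor S T p0 p1 p2 \<and>
    kem_diagram S L \<and> monad_of L = N \<and> map_kem p0 p1 p2 L = D \<and>
    (\<forall>L'. kem_diagram S L' \<and> monad_of L' = N \<and> map_kem p0 p1 p2 L' = D \<longrightarrow>
      (\<exists>!hg. kem_iso S L L' (fst hg) (snd hg) \<and>
        p1 (fst hg) = Id1 T (Kl D) \<and> p1 (snd hg) = Id1 T (EM D)))"


section \<open>The lax slice\<close>

definition lax_slice :: "('o, 'm, 'c) two_cat \<Rightarrow> 'o \<Rightarrow> ('o \<times> 'm, 'm \<times> 'c, 'c) two_cat"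
  where "lax_slice A M =
    \<lparr>Obj = {(B, b). B \<in> Obj A \<and> b \<in> Hom1 A B M},
     Hom1 = (\<lambda>(B, b) (C, c). {(F, \<theta>). b \<in> Hom1 A B M \<and> c \<in> Hom1 A C M \<and>
        F \<in> Hom1 A B C \<and> \<theta> \<in> Hom2 A B M (c \<odot> F) b}),
     Hom2 = (\<lambda>(B, b) (C, c) (F, \<theta>) (F', \<theta>'). {\<tau> \<in> Hom2 A B C F F'.
        b \<in> Hom1 A B M \<and> c \<in> Hom1 A C M \<and>
        \<theta> \<in> Hom2 A B M (c \<odot> F) b \<and> \<theta>' \<in> Hom2 A B M (c \<odot> F') b \<and> \<theta>' \<bullet> (c \<rhd> \<tau>) = \<theta>}),
     Id1 = (\<lambda>(B, b). (Id1 A B, Id2 A b)),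
     Comp1 = (\<lambda>(G, \<gamma>) (F, \<theta>). (G \<odot> F, \<theta> \<bullet> (\<gamma> \<lhd> F))),
     Id2 = (\<lambda>(F, \<theta>). Id2 A F),
     VComp = VComp A,
     HComp = HComp A\<rparr>"
  for A (structure)

text \<open>The domain 2-functor \<open>p\<close> is \<open>(fst, fst, \<lambda>\<tau>. \<tau>)\<close> on 0-, 1- and 2-cells.

  The lift of the Eilenberg--Moore part has the leg \<open>rE\<close>, the object part of a coequalizer
  \<open>q : r U\<^sup>R \<rightarrow> rE\<close>. Coequalizers being determined up to isomorphism only, the equation
  \<open>rE F\<^sup>R = r\<close> holds through the invertible comparison 2-cell \<open>v : rE F\<^sup>R \<rightarrow> r\<close> with
  \<open>v \<circ> q\<^sub>F = \<epsilon>\<^sub>r\<close>, and the 2-cell \<open>rE(\<epsilon>\<^sup>R) : r U\<^sup>R = rE F\<^sup>R U\<^sup>R \<rightarrow> rE\<close> is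
  \<open>(rE \<rhd> \<epsilon>\<^sup>R) \<bullet> (v\<inverse> \<lhd> U\<^sup>R)\<close>.\<close>

context two_category begin

lemma lwhisk_VComp:
  assumes "\<alpha> \<in> Hom2 A X Y f g" "\<beta> \<in> Hom2 A X Y g h" "k \<in> Hom1 A Y Z"
  shows "k \<rhd> (\<beta> \<bullet> \<alpha>) = (k \<rhd> \<beta>) \<bullet> (k \<rhd> \<alpha>)"
  unfolding lwhisk_def using interchange[OF assms(1,2) Id2_in[OF assms(3)] Id2_in[OF assms(3)]]
  by (simp add: VComp_Id_left[OF Id2_in[OF assms(3)]])

lemma rwhisk_VComp:
  assumes "\<alpha> \<in> Hom2 A Y Z f g" "\<beta> \<in> Hom2 A Y Z g h" "k \<in> Hom1 A X Y"
  shows "(\<beta> \<bullet> \<alpha>) \<lhd> k = (\<beta> \<lhd> k) \<bullet> (\<alpha> \<lhd> k)"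
  unfolding rwhisk_def using interchange[OF Id2_in[OF assms(3)] Id2_in[OF assms(3)] assms(1,2)]
  by (simp add: VComp_Id_left[OF Id2_in[OF assms(3)]])

lemma hcomp_decomp:
  assumes "\<alpha> \<in> Hom2 A X Y f f'" "\<beta> \<in> Hom2 A Y Z g g'"
  shows "\<beta> \<star> \<alpha> = (g' \<rhd> \<alpha>) \<bullet> (\<beta> \<lhd> f)" "\<beta> \<star> \<alpha> = (\<beta> \<lhd> f') \<bullet> (g \<rhd> \<alpha>)"
proof -
  have f: "f \<in> Hom1 A X Y" "f' \<in> Hom1 A X Y" "g \<in> Hom1 A Y Z" "g' \<in> Hom1 A Y Z"
    using assms Hom2_Hom1 by blast+
  show "\<beta> \<star> \<alpha> = (g' \<rhd> \<alpha>) \<bullet> (\<beta> \<lhd> f)" "\<beta> \<star> \<alpha> = (\<beta> \<lhd> f') \<bullet> (g \<rhd> \<alpha>)"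
    unfolding lwhisk_def rwhisk_def
    using interchange[OF Id2_in[OF f(1)] assms(1) assms(2) Id2_in[OF f(4)]]
       interchange[OF assms(1) Id2_in[OF f(2)] Id2_in[OF f(3)] assms(2)] assms
    by (simp_all add: VComp_Id_left VComp_Id_right)
qed

lemma lwhisk_in: "\<lbrakk>\<alpha> \<in> Hom2 A X Y f f'; g \<in> Hom1 A Y Z\<rbrakk> \<Longrightarrow> g \<rhd> \<alpha> \<in> Hom2 A X Z (g \<odot> f) (g \<odot> f')"
  unfolding lwhisk_def by (rule HComp_in[OF _ Id2_in])

lemma rwhisk_in: "\<lbrakk>f \<in> Hom1 A X Y; \<beta> \<in> Hom2 A Y Z g g'\<rbrakk> \<Longrightarrow> \<beta> \<lhd> f \<in> Hom2 A X Z (g \<odot> f) (g' \<odot> f)"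
  unfolding rwhisk_def by (rule HComp_in[OF Id2_in])

lemma lwhisk_Comp: "\<lbrakk>\<alpha> \<in> Hom2 A W X f f'; g \<in> Hom1 A X Y; h \<in> Hom1 A Y Z\<rbrakk> \<Longrightarrow> (h \<odot> g) \<rhd> \<alpha> = h \<rhd> (g \<rhd> \<alpha>)"
  unfolding lwhisk_def using HComp_assoc[OF _ Id2_in Id2_in] by (simp add: HComp_Id2[symmetric])

lemma rwhisk_Comp: "\<lbrakk>\<alpha> \<in> Hom2 A Y Z f f'; g \<in> Hom1 A X Y; h \<in> Hom1 A W X\<rbrakk> \<Longrightarrow> \<alpha> \<lhd> (g \<odot> h) = (\<alpha> \<lhd> g) \<lhd> h"
  unfolding rwhisk_def using HComp_assoc[OF Id2_in Id2_in] by (simp add: HComp_Id2[symmetric])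

lemma lrwhisk: "\<lbrakk>\<alpha> \<in> Hom2 A X Y f f'; h \<in> Hom1 A W X; g \<in> Hom1 A Y Z\<rbrakk> \<Longrightarrow> (g \<rhd> \<alpha>) \<lhd> h = g \<rhd> (\<alpha> \<lhd> h)"
  unfolding rwhisk_def lwhisk_def by (rule HComp_assoc[OF Id2_in _ Id2_in])

lemma lax_slice_two_category:
  "two_category (lax_slice A M)"
proof
  note [simp] = lax_slice_def
  fix f X Y assume "f \<in> Hom1 (lax_slice A M) X Y"
  then show "X \<in> Obj (lax_slice A M) \<and> Y \<in> Obj (lax_slice A M)"
    using Hom1_Obj by (auto split: prod.splits)
next
  fix \<alpha> f g X Y assume "\<alpha> \<in> Hom2 (lax_slice A M) X Y f g"
  then show "f \<in> Hom1 (lax_slice A M) X Y \<and> g \<in> Hom1 (lax_slice A M) X Y"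
    using Hom2_Hom1 by (auto simp: lax_slice_def split: prod.splits)
next
  fix X assume "X \<in> Obj (lax_slice A M)"
  then show "Id1 (lax_slice A M) X \<in> Hom1 (lax_slice A M) X X"
    using Id1_in Id2_in Comp1_Id_right by (auto simp: lax_slice_def split: prod.splits)
next
  fix X Y Z f g assume "f \<in> Hom1 (lax_slice A M) X Y" "g \<in> Hom1 (lax_slice A M) Y Z"
  then show "Comp1 (lax_slice A M) g f \<in> Hom1 (lax_slice A M) X Z"
    apply (clarsimp simp: lax_slice_def split: prod.splits)
    apply (intro conjI)
     apply (erule (1) Comp1_in)
    apply (rule VComp_in[rotated], assumption, subst Comp1_assoc[symmetric], assumption+, rule rwhisk_in, assumption+)
    done
next
  fix W X Y Z f g h assume p0: "f \<in> Hom1 (lax_slice A M) W X" "g \<in> Hom1 (lax_slice A M) X Y" "h \<in> Hom1 (lax_slice A M) Y Z"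
  show "Comp1 (lax_slice A M) (Comp1 (lax_slice A M) h g) f = Comp1 (lax_slice A M) h (Comp1 (lax_slice A M) g f)"
  proof -
      obtain B b C c D d E e F \<theta> G \<gamma> K \<delta> where eq: "W = (B,b)" "X = (C,c)" "Y = (D,d)" "Z = (E,e)"
        "f = (F,\<theta>)" "g = (G,\<gamma>)" "h = (K,\<delta>)" by (metis surj_pair)
      note p = p0[unfolded eq lax_slice_def, simplified]
      have 1: "\<delta> \<lhd> G \<in> Hom2 A C M (e \<odot> K \<odot> G) (d \<odot> G)"
        using rwhisk_in[of G C D \<delta> M "e \<odot> K" d] p by (simp add: Comp1_assoc[of G C D K E e M])
      have 2: "(\<gamma> \<bullet> (\<delta> \<lhd> G)) \<lhd> F = (\<gamma> \<lhd> F) \<bullet> ((\<delta> \<lhd> G) \<lhd> F)"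
        by (rule rwhisk_VComp[OF 1]) (use p in auto)
      have 3: "\<delta> \<lhd> (G \<odot> F) = (\<delta> \<lhd> G) \<lhd> F" by (rule rwhisk_Comp) (use p in auto)
      have 4: "(\<delta> \<lhd> G) \<lhd> F \<in> Hom2 A B M ((e \<odot> K \<odot> G) \<odot> F) ((d \<odot> G) \<odot> F)"
        by (rule rwhisk_in[OF _ 1]) (use p in auto)
      have 5: "\<gamma> \<lhd> F \<in> Hom2 A B M ((d \<odot> G) \<odot> F) (c \<odot> F)" by (rule rwhisk_in) (use p in auto)
      show ?thesis unfolding eq using p VComp_assoc[OF 4 5, of \<theta> b] by (simp add: lax_slice_def 2 3 Comp1_assoc[of F B C G D K E])
    qed
next
  fix f X Y assume "f \<in> Hom1 (lax_slice A M) X Y"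
  then show "Comp1 (lax_slice A M) (Id1 (lax_slice A M) Y) f = f" "Comp1 (lax_slice A M) f (Id1 (lax_slice A M) X) = f"
     apply (auto simp: lax_slice_def Comp1_Id_left Comp1_Id_right rwhisk_def HComp_Id2 HComp_Id_right VComp_Id_left VComp_Id_right split: prod.splits)
    done
next
  fix f X Y assume "f \<in> Hom1 (lax_slice A M) X Y"
  then show "Id2 (lax_slice A M) f \<in> Hom2 (lax_slice A M) X Y f f"
    apply (clarsimp simp: lax_slice_def Id2_in split: prod.splits)
    by (simp add: lwhisk_def HComp_Id2 VComp_Id_right)
next
  fix \<alpha> \<beta> f g h X Y assume p0: "\<alpha> \<in> Hom2 (lax_slice A M) X Y f g" "\<beta> \<in> Hom2 (lax_slice A M) X Y g h"
  show "VComp (lax_slice A M) \<beta> \<alpha> \<in> Hom2 (lax_slice A M) X Y f h"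
  proof -
      obtain B b C c F \<theta> G \<gamma> H \<delta> where eq: "X = (B,b)" "Y = (C,c)"
        "f = (F,\<theta>)" "g = (G,\<gamma>)" "h = (H,\<delta>)" by (metis surj_pair)
      note p = p0[unfolded eq lax_slice_def, simplified]
      show ?thesis unfolding eq lax_slice_def
      using p VComp_in[of \<alpha> B C F G \<beta> H] lwhisk_VComp[of \<alpha> B C F G \<beta> H c M]
        VComp_assoc[OF lwhisk_in[of \<alpha> B C F G c M] lwhisk_in[of \<beta> B C G H c M], of \<delta> b] by simp
    qed
next
  fix \<alpha> \<beta> \<gamma> f g h k X Y assume "\<alpha> \<in> Hom2 (lax_slice A M) X Y f g" "\<beta> \<in> Hom2 (lax_slice A M) X Y g h"
     "\<gamma> \<in> Hom2 (lax_slice A M) X Y h k"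
  then show "VComp (lax_slice A M) (VComp (lax_slice A M) \<gamma> \<beta>) \<alpha> = VComp (lax_slice A M) \<gamma> (VComp (lax_slice A M) \<beta> \<alpha>)"
    by (auto simp: lax_slice_def VComp_assoc split: prod.splits)
next
  fix \<alpha> f g X Y assume "\<alpha> \<in> Hom2 (lax_slice A M) X Y f g"
  then show "VComp (lax_slice A M) (Id2 (lax_slice A M) g) \<alpha> = \<alpha>" "VComp (lax_slice A M) \<alpha> (Id2 (lax_slice A M) f) = \<alpha>"
   "HComp (lax_slice A M) (Id2 (lax_slice A M) (Id1 (lax_slice A M) Y)) \<alpha> = \<alpha>"
   "HComp (lax_slice A M) \<alpha> (Id2 (lax_slice A M) (Id1 (lax_slice A M) X)) = \<alpha>"
    by (auto simp: lax_slice_def VComp_Id_left VComp_Id_right HComp_Id_left HComp_Id_right split: prod.splits)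
next
  fix X Y Z f f' g g' \<alpha> \<beta> assume p0: "\<alpha> \<in> Hom2 (lax_slice A M) X Y f f'" "\<beta> \<in> Hom2 (lax_slice A M) Y Z g g'"
  show "HComp (lax_slice A M) \<beta> \<alpha> \<in> Hom2 (lax_slice A M) X Z (Comp1 (lax_slice A M) g f) (Comp1 (lax_slice A M) g' f')"
  proof -
      obtain B b C c D d F \<theta> F' \<theta>' G \<gamma> G' \<gamma>' where eq: "X = (B,b)" "Y = (C,c)" "Z = (D,d)"
        "f = (F,\<theta>)" "g = (G,\<gamma>)" "f' = (F',\<theta>')" "g' = (G',\<gamma>')" by (metis surj_pair)
      note p = p0[unfolded eq lax_slice_def, simplified]
      have F: "F \<in> Hom1 A B C" "F' \<in> Hom1 A B C" "G \<in> Hom1 A C D" "G' \<in> Hom1 A C D" using p Hom2_Hom1 by blast+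
      have "d \<rhd> (\<beta> \<star> \<alpha>) = (d \<rhd> (\<beta> \<lhd> F')) \<bullet> (d \<rhd> (G \<rhd> \<alpha>))"
        using p F hcomp_decomp(2)[of \<alpha> B C F F' \<beta> D G G'] lwhisk_VComp[of "G \<rhd> \<alpha>" B D "G \<odot> F" "G \<odot> F'" "\<beta> \<lhd> F'" "G' \<odot> F'" d M] lwhisk_in[of \<alpha> B C F F' G D] rwhisk_in[of F' B C \<beta> D G G'] by auto
      also have "\<dots> = ((d \<rhd> \<beta>) \<lhd> F') \<bullet> ((d \<odot> G) \<rhd> \<alpha>)"
        using p F lrwhisk[of \<beta> C D G G' F' B d M] lwhisk_Comp[of \<alpha> B C F F' G D d M] by auto
      finally have 1: "d \<rhd> (\<beta> \<star> \<alpha>) = ((d \<rhd> \<beta>) \<lhd> F') \<bullet> ((d \<odot> G) \<rhd> \<alpha>)" .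
      have t1: "(d \<odot> G) \<rhd> \<alpha> \<in> Hom2 A B M ((d \<odot> G) \<odot> F) ((d \<odot> G) \<odot> F')" using p F Comp1_in lwhisk_in by blast
      have t2: "(d \<rhd> \<beta>) \<lhd> F' \<in> Hom2 A B M ((d \<odot> G) \<odot> F') ((d \<odot> G') \<odot> F')" using p F lwhisk_in rwhisk_in by blast
      have t3: "\<gamma>' \<lhd> F' \<in> Hom2 A B M ((d \<odot> G') \<odot> F') (c \<odot> F')" using p F rwhisk_in by blast
      have t4: "(d \<rhd> \<beta>) \<in> Hom2 A C M (d \<odot> G) (d \<odot> G')" using p lwhisk_in by blast
      have t5: "\<gamma> \<lhd> F \<in> Hom2 A B M ((d \<odot> G) \<odot> F) (c \<odot> F)" "c \<rhd> \<alpha> \<in> Hom2 A B M (c \<odot> F) (c \<odot> F')" using p F rwhisk_in lwhisk_in by blast+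
      have "(\<theta>' \<bullet> (\<gamma>' \<lhd> F')) \<bullet> (d \<rhd> (\<beta> \<star> \<alpha>)) = \<theta>' \<bullet> (((\<gamma>' \<lhd> F') \<bullet> ((d \<rhd> \<beta>) \<lhd> F')) \<bullet> ((d \<odot> G) \<rhd> \<alpha>))"
        unfolding 1 using VComp_assoc[OF VComp_in[OF t1 t2] t3, of \<theta>' b] VComp_assoc[OF t1 t2 t3] p by simp
      also have "(\<gamma>' \<lhd> F') \<bullet> ((d \<rhd> \<beta>) \<lhd> F') = \<gamma> \<lhd> F'" using rwhisk_VComp[OF t4 _ F(2), of \<gamma>' c] p by auto
      also have "(\<gamma> \<lhd> F') \<bullet> ((d \<odot> G) \<rhd> \<alpha>) = (c \<rhd> \<alpha>) \<bullet> (\<gamma> \<lhd> F)"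
        using hcomp_decomp[of \<alpha> B C F F' \<gamma> M "d \<odot> G" c] p by auto
      also have "\<theta>' \<bullet> (c \<rhd> \<alpha>) \<bullet> (\<gamma> \<lhd> F) = \<theta> \<bullet> (\<gamma> \<lhd> F)" using VComp_assoc[OF t5, of \<theta>' b] p by simp
      finally show ?thesis unfolding eq lax_slice_def
        using p VComp_in[OF t5(1), of \<theta> b] VComp_in[OF t3, of \<theta>' b] HComp_in[of \<alpha> B C F F' \<beta> D G G'] F
        by (simp add: Comp1_assoc[of F B C G D d M] Comp1_assoc[of F' B C G' D d M])
    qed
next
  fix W X Y Z f f' g g' h h' \<alpha> \<beta> \<gamma> assume "\<alpha> \<in> Hom2 (lax_slice A M) W X f f'" "\<beta> \<in> Hom2 (lax_slice A M) X Y g g'" "\<gamma> \<in> Hom2 (lax_slice A M) Y Z h h'"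
  then show "HComp (lax_slice A M) (HComp (lax_slice A M) \<gamma> \<beta>) \<alpha> = HComp (lax_slice A M) \<gamma> (HComp (lax_slice A M) \<beta> \<alpha>)"
    by (auto simp: lax_slice_def HComp_assoc split: prod.splits)
next
  fix X Y Z f g assume "f \<in> Hom1 (lax_slice A M) X Y" "g \<in> Hom1 (lax_slice A M) Y Z"
  then show "HComp (lax_slice A M) (Id2 (lax_slice A M) g) (Id2 (lax_slice A M) f) = Id2 (lax_slice A M) (Comp1 (lax_slice A M) g f)"
    by (auto simp: lax_slice_def HComp_Id2 split: prod.splits)
next
  fix X Y Z f f' f'' g g' g'' \<alpha> \<alpha>' \<beta> \<beta>' 
  assume "\<alpha> \<in> Hom2 (lax_slice A M) X Y f f'" "\<alpha>' \<in> Hom2 (lax_slice A M) X Y f' f''"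
     "\<beta> \<in> Hom2 (lax_slice A M) Y Z g g'" "\<beta>' \<in> Hom2 (lax_slice A M) Y Z g' g''"
  then show "HComp (lax_slice A M) (VComp (lax_slice A M) \<beta>' \<beta>) (VComp (lax_slice A M) \<alpha>' \<alpha>)
    = VComp (lax_slice A M) (HComp (lax_slice A M) \<beta>' \<alpha>') (HComp (lax_slice A M) \<beta> \<alpha>)"
    by (auto simp: lax_slice_def interchange split: prod.splits)
qed

lemma two_functor_dom: "two_functor (lax_slice A M) A fst fst (\<lambda>\<tau>. \<tau>)"
  by (simp add: two_functor_def lax_slice_def split_beta)
end

end

theory Submission
  imports Defs
begin

text \<open>
  A kem-diagram is determined by its monad together with the Kleisli object and the
  Eilenberg--Moore object: the two adjunctions and the comparison 1-cell are forced by the two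
  universal properties (\<open>kem_diagram_ex1\<close>), and two kem-diagrams of one monad are related by a
  unique isomorphism (\<open>kem_iso_ex1\<close>). Both facts hold in every 2-category, so they can be used in
  \<open>\<A>\<close> and in the lax slice alike. Creation of the kem-diagram thereby reduces to two
  assertions: the lifted cells form a Kleisli object and an Eilenberg--Moore object for the lifted
  monad. Everything else about the lift follows by comparing it with its image in \<open>\<A>\<close>.

  The monad lifts because the whole adjunction \<open>r \<stileturn> U\<close> does: in the slice, \<open>(r, id)\<close> is left
  adjoint to \<open>(U, \<epsilon>)\<close>, between \<open>(C, r)\<close> and \<open>(M, id)\<close>. A 1-cell of the slice carrying a
  sub(co)equalizing is a sub(co)equalizing of \<open>\<A>\<close> together with a 2-cell \<open>\<theta>\<close> subject to one equation.

  For a subcoequalizing \<open>(v, \<nu>)\<close> on \<open>(X, x)\<close>, the equation says that \<open>\<theta> : x v \<rightarrow> r\<close> is a morphism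
  of subcoequalizings from \<open>(x v, x(\<nu>))\<close> to \<open>(r, \<epsilon>\<^sub>r)\<close>. The 2-dimensional part of the Kleisli
  property turns it into a 2-cell into the 1-cell \<open>t\<close> induced by \<open>(r, \<epsilon>\<^sub>r)\<close>, hence the leg \<open>t\<close> is
  the right one (\<open>lifted_kleisli_object\<close>).

  For a subequalizing \<open>(v, \<nu>)\<close> with \<open>v = u k\<close>, \<open>\<nu> = \<beta>\<^sub>k\<close>, the equation says that
  \<open>\<theta> : r u k \<rightarrow> x\<close> coequalizes \<open>r(\<beta>)\<^sub>k\<close> and \<open>\<epsilon>\<^bsub>r u k\<^esub>\<close>. Since \<open>M\<close> is an rc 0-cell, the
  coequalizer \<open>q : r u \<rightarrow> s\<close> is preserved by precomposition with \<open>k\<close>, so \<open>\<theta>\<close> is the same as a 2-cell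
  \<open>s k \<rightarrow> x\<close>. This makes \<open>((E, s), (u, q))\<close> an Eilenberg--Moore object of the lifted monad
  (\<open>lifted_em_object\<close>). That the leg \<open>q\<close> of \<open>u\<close> is \<open>s(e)\<close> up to the invertible 2-cell
  \<open>v : s F \<rightarrow> r\<close> is an interchange computation (\<open>leg_of_u\<close>); \<open>v\<close> is invertible because \<open>q\<^sub>F\<close> and
  \<open>\<epsilon>\<^sub>r\<close> coequalize the same pair, the second one being split by \<open>\<eta>\<close> (\<open>v_inverse\<close>). The adjunction
  \<open>s \<stileturn> K\<close> is the lifting construction of Dubuc and Beck: its unit and counit are transposes of
  \<open>q\<close> and of the identity of \<open>U\<close> (\<open>leg_left_adjoint\<close>).

  Kleisli objects are Eilenberg--Moore objects of the 2-category with reversed 1-cells, so every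
  statement about adjunctions of Kleisli objects is obtained by duality.
\<close>


section \<open>Whiskering\<close>

context two_category begin

lemma lwhisk_Id1: "\<alpha> \<in> Hom2 A X Y f g \<Longrightarrow> Id1 A Y \<rhd> \<alpha> = \<alpha>"
  by (simp add: lwhisk_def HComp_Id_left)

lemma rwhisk_Id1: "\<alpha> \<in> Hom2 A X Y f g \<Longrightarrow> \<alpha> \<lhd> Id1 A X = \<alpha>"
  by (simp add: rwhisk_def HComp_Id_right)

lemma lwhisk_Id2: "\<lbrakk>f \<in> Hom1 A X Y; g \<in> Hom1 A Y Z\<rbrakk> \<Longrightarrow> g \<rhd> Id2 A f = Id2 A (g \<odot> f)"
  by (simp add: lwhisk_def HComp_Id2)

lemma rwhisk_Id2: "\<lbrakk>f \<in> Hom1 A X Y; g \<in> Hom1 A Y Z\<rbrakk> \<Longrightarrow> Id2 A g \<lhd> f = Id2 A (g \<odot> f)"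
  by (simp add: rwhisk_def HComp_Id2)

lemma whisker_swap:
  assumes "\<alpha> \<in> Hom2 A X Y f f'" "\<beta> \<in> Hom2 A Y Z g g'"
  shows "(g' \<rhd> \<alpha>) \<bullet> (\<beta> \<lhd> f) = (\<beta> \<lhd> f') \<bullet> (g \<rhd> \<alpha>)"
  using hcomp_decomp[OF assms] by simp

end


section \<open>Reversing 1-cells\<close>

text \<open>
  Reversing 1-cells but not 2-cells exchanges left and right adjoints while keeping unit and counit.
  It fixes monads and exchanges subequalizings with subcoequalizings.
\<close>

definition op1 :: "('o, 'm, 'c) two_cat \<Rightarrow> ('o, 'm, 'c) two_cat"
  where "op1 A = \<lparr>Obj = Obj A, Hom1 = (\<lambda>X Y. Hom1 A Y X), Hom2 = (\<lambda>X Y. Hom2 A Y X),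
    Id1 = Id1 A, Comp1 = (\<lambda>g f. Comp1 A f g), Id2 = Id2 A, VComp = VComp A,
    HComp = (\<lambda>b a. HComp A a b)\<rparr>"

lemma op1_simps [simp]:
  "Obj (op1 A) = Obj A" "Hom1 (op1 A) X Y = Hom1 A Y X" "Hom2 (op1 A) X Y = Hom2 A Y X"
  "Id1 (op1 A) = Id1 A" "Id2 (op1 A) = Id2 A"
  "Comp1 (op1 A) g f = Comp1 A f g" "VComp (op1 A) = VComp A" "HComp (op1 A) b a = HComp A a b"
  by (simp_all add: op1_def)

lemma op1_whisk [simp]:
  "lwhisk (op1 A) g \<tau> = rwhisk A \<tau> g" "rwhisk (op1 A) \<tau> g = lwhisk A g \<tau>"
  by (simp_all add: lwhisk_def rwhisk_def)

lemma (in two_category) op1_two_category: "two_category (op1 A)"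
proof unfold_locales
  fix f X Y assume "f \<in> Hom1 (op1 A) X Y"
  then show "X \<in> Obj (op1 A) \<and> Y \<in> Obj (op1 A)" using Hom1_Obj by auto
next
  fix \<alpha> X Y f g assume "\<alpha> \<in> Hom2 (op1 A) X Y f g"
  then show "f \<in> Hom1 (op1 A) X Y \<and> g \<in> Hom1 (op1 A) X Y" using Hom2_Hom1 by auto
qed (auto intro: Id1_in Comp1_in Comp1_assoc[symmetric] Comp1_Id_left Comp1_Id_right Id2_in VComp_in
    VComp_assoc VComp_Id_left VComp_Id_right HComp_in HComp_assoc[symmetric] HComp_Id_left
    HComp_Id_right HComp_Id2 interchange)

lemma op1_is_monad [simp]: "is_monad (op1 A) N = is_monad A N"
  by (auto simp: is_monad_def Let_def)

lemma op1_adjunction [simp]: "adjunction (op1 A) X Y u l \<eta> \<epsilon> = adjunction A X Y l u \<eta> \<epsilon>"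
  by (auto simp: adjunction_def)

lemma op1_iso_1cell [simp]: "iso_1cell (op1 A) X Y h = iso_1cell A Y X h"
  by (auto simp: iso_1cell_def)

lemma op1_Subeq: "Subeq (op1 A) N X = Subcoeq A N X"
  by (auto simp: Subeq_def Subcoeq_def)

lemma op1_Subeq_mor: "Subeq_mor (op1 A) N X s t = Subcoeq_mor A N X s t"
  by (auto simp: Subeq_mor_def Subcoeq_mor_def)

lemma op1_em_object: "em_object (op1 A) N L f \<kappa> = kleisli_object A N L f \<kappa>"
  by (simp add: em_object_def kleisli_object_def op1_Subeq op1_Subeq_mor)


section \<open>Monads induced by adjunctions\<close>

context two_category begin

text \<open>
  The right adjoint is an algebra of its own monad with action \<open>u(\<epsilon>)\<close>. Associativity is \<open>u\<close>
  applied to the third equation, which is the interchange law for \<open>\<epsilon>\<close> with itself.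
\<close>

lemma adjunction_action:
  assumes "adjunction A X Y l u \<eta> \<epsilon>"
  shows "(u \<rhd> \<epsilon>) \<bullet> ((u \<odot> l) \<rhd> (u \<rhd> \<epsilon>)) = (u \<rhd> \<epsilon>) \<bullet> ((u \<rhd> (\<epsilon> \<lhd> l)) \<lhd> u)"
    and "u \<rhd> \<epsilon> \<in> Hom2 A Y X ((u \<odot> l) \<odot> u) u"
    and "\<epsilon> \<bullet> (\<epsilon> \<lhd> (l \<odot> u)) = \<epsilon> \<bullet> ((l \<odot> u) \<rhd> \<epsilon>)"
proof -
  have l: "l \<in> Hom1 A X Y" and u: "u \<in> Hom1 A Y X"
    and e: "\<epsilon> \<in> Hom2 A Y Y (l \<odot> u) (Id1 A Y)"
    using assms by (auto simp: adjunction_def)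
  have Y: "Y \<in> Obj A" using Hom1_Obj[OF l] by simp
  note lu = Comp1_in[OF u l]
  show t: "u \<rhd> \<epsilon> \<in> Hom2 A Y X ((u \<odot> l) \<odot> u) u"
    using lwhisk_in[OF e u] by (simp add: Comp1_Id_right[OF u] Comp1_assoc[OF u l u])
  show *: "\<epsilon> \<bullet> (\<epsilon> \<lhd> (l \<odot> u)) = \<epsilon> \<bullet> ((l \<odot> u) \<rhd> \<epsilon>)"
    using whisker_swap[OF e e] by (simp add: lwhisk_Id1[OF e] rwhisk_Id1[OF e])
  have t1: "\<epsilon> \<lhd> (l \<odot> u) \<in> Hom2 A Y Y ((l \<odot> u) \<odot> (l \<odot> u)) (l \<odot> u)"
    using rwhisk_in[OF lu e] by (simp add: Comp1_Id_left[OF lu])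
  have t2: "(l \<odot> u) \<rhd> \<epsilon> \<in> Hom2 A Y Y ((l \<odot> u) \<odot> (l \<odot> u)) (l \<odot> u)"
    using lwhisk_in[OF e lu] by (simp add: Comp1_Id_right[OF lu])
  have el: "\<epsilon> \<lhd> l \<in> Hom2 A X Y ((l \<odot> u) \<odot> l) l"
    using rwhisk_in[OF l e] by (simp add: Comp1_Id_left[OF l])
  have "(u \<rhd> \<epsilon>) \<bullet> (u \<rhd> (\<epsilon> \<lhd> (l \<odot> u))) = (u \<rhd> \<epsilon>) \<bullet> (u \<rhd> ((l \<odot> u) \<rhd> \<epsilon>))"
    using lwhisk_VComp[OF t1 e u] lwhisk_VComp[OF t2 e u] * by simp
  then show "(u \<rhd> \<epsilon>) \<bullet> ((u \<odot> l) \<rhd> (u \<rhd> \<epsilon>)) = (u \<rhd> \<epsilon>) \<bullet> ((u \<rhd> (\<epsilon> \<lhd> l)) \<lhd> u)"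
    by (simp add: rwhisk_Comp[OF e l u] lrwhisk[OF el u u] lwhisk_Comp[OF e u l]
        lwhisk_Comp[OF lwhisk_in[OF e u] l u])
qed

text \<open>
  Two of the monad laws are the laws of the algebra \<open>(u, u(\<epsilon>))\<close> precomposed with \<open>l\<close>; the
  remaining unit law is \<open>u\<close> applied to the other triangle identity.
\<close>

lemma adjunction_is_monad:
  assumes "adjunction A X Y l u \<eta> \<epsilon>"
  shows "is_monad A \<lparr>Base = X, Endo = u \<odot> l, MUnit = \<eta>, Mult = u \<rhd> (\<epsilon> \<lhd> l)\<rparr>"
proof -
  have l: "l \<in> Hom1 A X Y" and u: "u \<in> Hom1 A Y X"
    and n: "\<eta> \<in> Hom2 A X X (Id1 A X) (u \<odot> l)" and e: "\<epsilon> \<in> Hom2 A Y Y (l \<odot> u) (Id1 A Y)"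
    and tri: "(\<epsilon> \<lhd> l) \<bullet> (l \<rhd> \<eta>) = Id2 A l" "(u \<rhd> \<epsilon>) \<bullet> (\<eta> \<lhd> u) = Id2 A u"
    using assms by (auto simp: adjunction_def)
  have X: "X \<in> Obj A" using Hom1_Obj[OF l] by simp
  note ul = Comp1_in[OF l u]
  have el: "\<epsilon> \<lhd> l \<in> Hom2 A X Y (l \<odot> (u \<odot> l)) l"
    using rwhisk_in[OF l e] by (simp add: Comp1_Id_left[OF l] Comp1_assoc[OF l u l])
  have ln: "l \<rhd> \<eta> \<in> Hom2 A X Y l (l \<odot> (u \<odot> l))"
    using lwhisk_in[OF n l] by (simp add: Comp1_Id_right[OF l])
  have nu: "\<eta> \<lhd> u \<in> Hom2 A Y X u ((u \<odot> l) \<odot> u)"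
    using rwhisk_in[OF u n] by (simp add: Comp1_Id_left[OF u])
  have m: "u \<rhd> (\<epsilon> \<lhd> l) \<in> Hom2 A X X ((u \<odot> l) \<odot> (u \<odot> l)) (u \<odot> l)"
    using lwhisk_in[OF el u] by (simp add: Comp1_assoc[OF ul l u])
  note ue = adjunction_action(2)[OF assms]
  have m': "u \<rhd> (\<epsilon> \<lhd> l) = (u \<rhd> \<epsilon>) \<lhd> l" using lrwhisk[OF e l u] by simp
  have 1: "(u \<rhd> (\<epsilon> \<lhd> l)) \<bullet> ((u \<odot> l) \<rhd> \<eta>) = Id2 A (u \<odot> l)"
    using lwhisk_VComp[OF ln el u] tri(1)
    by (simp add: lwhisk_Comp[OF n l u] lwhisk_Id2[OF l u])
  have 2: "(u \<rhd> (\<epsilon> \<lhd> l)) \<bullet> (\<eta> \<lhd> (u \<odot> l)) = Id2 A (u \<odot> l)"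
    unfolding m' using rwhisk_VComp[OF nu ue l] tri(2)
    by (simp add: rwhisk_Comp[OF n u l] rwhisk_Id2[OF l u])
  have a: "(u \<odot> l) \<rhd> (u \<rhd> \<epsilon>) \<in> Hom2 A Y X ((u \<odot> l) \<odot> ((u \<odot> l) \<odot> u)) ((u \<odot> l) \<odot> u)"
    by (rule lwhisk_in[OF ue ul])
  have b: "(u \<rhd> (\<epsilon> \<lhd> l)) \<lhd> u \<in> Hom2 A Y X (((u \<odot> l) \<odot> (u \<odot> l)) \<odot> u) ((u \<odot> l) \<odot> u)"
    by (rule rwhisk_in[OF u m])
  have 3: "(u \<rhd> (\<epsilon> \<lhd> l)) \<bullet> ((u \<odot> l) \<rhd> (u \<rhd> (\<epsilon> \<lhd> l))) =
      (u \<rhd> (\<epsilon> \<lhd> l)) \<bullet> ((u \<rhd> (\<epsilon> \<lhd> l)) \<lhd> (u \<odot> l))"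
    using arg_cong[OF adjunction_action(1)[OF assms], of "\<lambda>t. t \<lhd> l"]
    by (simp add: rwhisk_VComp[OF a ue l] rwhisk_VComp[OF b ue l] lrwhisk[OF ue l ul]
        rwhisk_Comp[OF m u l] m'[symmetric])
  show ?thesis using X ul n m 1 2 3 by (simp add: is_monad_def Let_def)
qed

end

section \<open>Eilenberg--Moore objects and their adjunctions\<close>

context two_category begin

lemma em_object_1cell_ex1:
  assumes em: "em_object A N E u \<beta>" and s: "(v, \<nu>) \<in> Subeq A N X"
  shows "\<exists>!k. k \<in> Hom1 A X E \<and> u \<odot> k = v \<and> \<beta> \<lhd> k = \<nu>"
proof -
  have X: "X \<in> Obj A" using s Hom1_Obj by (auto simp: Subeq_def)
  have b: "bij_betw (\<lambda>k. (u \<odot> k, \<beta> \<lhd> k)) (Hom1 A X E) (Subeq A N X)"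
    using em X by (simp add: em_object_def)
  obtain k where "k \<in> Hom1 A X E" "(u \<odot> k, \<beta> \<lhd> k) = (v, \<nu>)"
    using s bij_betw_imp_surj_on[OF b] by (metis (no_types, lifting) imageE)
  then show ?thesis using bij_betw_imp_inj_on[OF b] by (auto simp: inj_on_def)
qed

lemma em_object_1cell_eqI:
  assumes em: "em_object A N E u \<beta>" and k: "k \<in> Hom1 A X E" "k' \<in> Hom1 A X E"
    and eq: "u \<odot> k = u \<odot> k'" "\<beta> \<lhd> k = \<beta> \<lhd> k'"
  shows "k = k'"
proof -
  have "X \<in> Obj A" using k Hom1_Obj by blast
  then have "inj_on (\<lambda>k. (u \<odot> k, \<beta> \<lhd> k)) (Hom1 A X E)"
    using em by (auto simp: em_object_def bij_betw_def)
  then show ?thesis using k eq by (auto simp: inj_on_def)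
qed

lemma em_object_2cell_ex1:
  assumes em: "em_object A N E u \<beta>" and k: "k \<in> Hom1 A X E" "k' \<in> Hom1 A X E"
    and s: "\<sigma> \<in> Hom2 A X (Base N) (u \<odot> k) (u \<odot> k')" "\<sigma> \<bullet> (\<beta> \<lhd> k) = (\<beta> \<lhd> k') \<bullet> (Endo N \<rhd> \<sigma>)"
  shows "\<exists>!\<tau>. \<tau> \<in> Hom2 A X E k k' \<and> u \<rhd> \<tau> = \<sigma>"
proof -
  have X: "X \<in> Obj A" using k Hom1_Obj by blast
  then have b: "bij_betw (\<lambda>\<tau>. u \<rhd> \<tau>) (Hom2 A X E k k')
      (Subeq_mor A N X (u \<odot> k, \<beta> \<lhd> k) (u \<odot> k', \<beta> \<lhd> k'))"
    using em k by (auto simp: em_object_def)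
  have "\<sigma> \<in> Subeq_mor A N X (u \<odot> k, \<beta> \<lhd> k) (u \<odot> k', \<beta> \<lhd> k')"
    using s by (simp add: Subeq_mor_def)
  then obtain \<tau> where "\<tau> \<in> Hom2 A X E k k'" "u \<rhd> \<tau> = \<sigma>"
    using bij_betw_imp_surj_on[OF b] by (metis (no_types, lifting) imageE)
  then show ?thesis using bij_betw_imp_inj_on[OF b] by (auto simp: inj_on_def)
qed

lemma em_object_2cell_eqI:
  assumes em: "em_object A N E u \<beta>" and t: "\<tau> \<in> Hom2 A X E k k'" "\<tau>' \<in> Hom2 A X E k k'"
    and eq: "u \<rhd> \<tau> = u \<rhd> \<tau>'"
  shows "\<tau> = \<tau>'"
proof -
  have k: "k \<in> Hom1 A X E" "k' \<in> Hom1 A X E" using t Hom2_Hom1 by blast+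
  then have "X \<in> Obj A" using Hom1_Obj by blast
  then have "inj_on (\<lambda>\<tau>. u \<rhd> \<tau>) (Hom2 A X E k k')"
    using em k by (auto simp: em_object_def bij_betw_def)
  then show ?thesis using t eq by (auto simp: inj_on_def)
qed

lemma em_object_in:
  assumes "em_object A N E u \<beta>"
  shows "E \<in> Obj A" "u \<in> Hom1 A E (Base N)" "\<beta> \<in> Hom2 A E (Base N) (Endo N \<odot> u) u"
    "\<beta> \<bullet> (MUnit N \<lhd> u) = Id2 A u" "\<beta> \<bullet> (Endo N \<rhd> \<beta>) = \<beta> \<bullet> (Mult N \<lhd> u)"
  using assms by (auto simp: em_object_def Subeq_def)

text \<open>
  The algebra \<open>(v, v(\<epsilon>))\<close> factors uniquely through the Eilenberg--Moore object. In the 2-category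
  with reversed 1-cells this yields the 1-cell out of a Kleisli object induced by the left adjoint.
\<close>

lemma adjunction_comparison_ex1:
  assumes adj: "adjunction A C X l v \<eta> \<epsilon>" and em: "em_object A N E u \<beta>"
    and N: "N = \<lparr>Base = C, Endo = v \<odot> l, MUnit = \<eta>, Mult = v \<rhd> (\<epsilon> \<lhd> l)\<rparr>"
  shows "\<exists>!k. comparison A E u \<beta> X v \<epsilon> k"
proof -
  have "(v, v \<rhd> \<epsilon>) \<in> Subeq A N X"
    using adj adjunction_action[OF adj] by (simp add: Subeq_def N adjunction_def)
  from em_object_1cell_ex1[OF em this] show ?thesis by (simp add: comparison_def)
qed

end

text \<open>
  The Eilenberg--Moore half of a kem-diagram. Read with reversed 1-cells it is the Kleisli half,
  where \<open>u\<close> is the left adjoint out of the base and \<open>F\<close> the right adjoint.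
\<close>

definition em_adjunction :: "('o, 'm, 'c) two_cat \<Rightarrow> ('o, 'm, 'c) monad_data \<Rightarrow> 'o \<Rightarrow> 'm \<Rightarrow> 'm \<Rightarrow> 'c \<Rightarrow> 'c \<Rightarrow> bool"
  where "em_adjunction A N E F u \<beta> \<epsilon> \<longleftrightarrow> em_object A N E u \<beta> \<and>
    adjunction A (Base N) E F u (MUnit N) \<epsilon> \<and> u \<odot> F = Endo N \<and> \<beta> \<lhd> F = Mult N \<and> u \<rhd> \<epsilon> = \<beta>"
  for A (structure)

context two_category begin

text \<open>
  The left adjoint \<open>F\<close> classifies the free algebra \<open>(R, \<mu>)\<close>. The counit is the 2-cell \<open>F u \<rightarrow> id\<close>
  classified by \<open>\<beta>\<close>, which is a morphism of algebras by associativity of the action.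
  Since \<open>u\<close> is faithful on 2-cells, one triangle identity reduces to a unit law of the monad; the
  other is the unit law of the algebra \<open>(u, \<beta>)\<close>.
\<close>

lemma em_adjunction_exists:
  assumes mon: "is_monad A N" and em: "em_object A N E u \<beta>"
  shows "\<exists>F \<epsilon>. em_adjunction A N E F u \<beta> \<epsilon>"
proof -
  define C R \<eta> \<mu> where "C = Base N" and "R = Endo N" and "\<eta> = MUnit N" and "\<mu> = Mult N"
  note d = C_def[symmetric] R_def[symmetric] \<eta>_def[symmetric] \<mu>_def[symmetric]
  have R: "R \<in> Hom1 A C C" and n: "\<eta> \<in> Hom2 A C C (Id1 A C) R" and m: "\<mu> \<in> Hom2 A C C (R \<odot> R) R"
    and mon': "\<mu> \<bullet> (R \<rhd> \<mu>) = \<mu> \<bullet> (\<mu> \<lhd> R)" "\<mu> \<bullet> (R \<rhd> \<eta>) = Id2 A R" "\<mu> \<bullet> (\<eta> \<lhd> R) = Id2 A R"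
    using mon by (auto simp: is_monad_def Let_def d)
  note em' = em_object_in[OF em, unfolded d]
  note E = em'(1) and u = em'(2) and b = em'(3)
  have "(R, \<mu>) \<in> Subeq A N C" using R m mon' by (simp add: Subeq_def d)
  from em_object_1cell_ex1[OF em this] obtain F where
    F: "F \<in> Hom1 A C E" and uF: "u \<odot> F = R" and bF: "\<beta> \<lhd> F = \<mu>" by blast
  note Fu = Comp1_in[OF u F]
  have ext: "u \<odot> (F \<odot> u) = R \<odot> u" "\<beta> \<lhd> (F \<odot> u) = \<mu> \<lhd> u"
    using Comp1_assoc[OF u F u] rwhisk_Comp[OF b F u] by (simp_all add: uF bF)
  have idE: "u \<odot> Id1 A E = u" "\<beta> \<lhd> Id1 A E = \<beta>"
    using Comp1_Id_right[OF u] rwhisk_Id1[OF b] by simp_all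
  have "\<exists>!\<tau>. \<tau> \<in> Hom2 A E E (F \<odot> u) (Id1 A E) \<and> u \<rhd> \<tau> = \<beta>"
    by (rule em_object_2cell_ex1[OF em Fu Id1_in[OF E]]) (simp_all add: d ext idE b em')
  then obtain \<epsilon> where e: "\<epsilon> \<in> Hom2 A E E (F \<odot> u) (Id1 A E)" and ue: "u \<rhd> \<epsilon> = \<beta>" by blast
  have eF: "\<epsilon> \<lhd> F \<in> Hom2 A C E (F \<odot> R) F"
    using rwhisk_in[OF F e] by (simp add: Comp1_assoc[OF F u F] uF Comp1_Id_left[OF F])
  have Fn: "F \<rhd> \<eta> \<in> Hom2 A C E F (F \<odot> R)"
    using lwhisk_in[OF n F] by (simp add: Comp1_Id_right[OF F])
  have "(\<epsilon> \<lhd> F) \<bullet> (F \<rhd> \<eta>) = Id2 A F"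
  proof (rule em_object_2cell_eqI[OF em VComp_in[OF Fn eF] Id2_in[OF F]])
    have "u \<rhd> ((\<epsilon> \<lhd> F) \<bullet> (F \<rhd> \<eta>)) = (u \<rhd> (\<epsilon> \<lhd> F)) \<bullet> (u \<rhd> (F \<rhd> \<eta>))"
      by (rule lwhisk_VComp[OF Fn eF u])
    also have "\<dots> = \<mu> \<bullet> (R \<rhd> \<eta>)"
      using lrwhisk[OF e F u] lwhisk_Comp[OF n F u] by (simp add: ue bF uF)
    finally show "u \<rhd> ((\<epsilon> \<lhd> F) \<bullet> (F \<rhd> \<eta>)) = u \<rhd> Id2 A F"
      by (simp add: mon' lwhisk_Id2[OF F u] uF)
  qed
  then have "em_adjunction A N E F u \<beta> \<epsilon>"
    using em F u n e by (simp add: em_adjunction_def adjunction_def d uF bF ue em')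
  then show ?thesis by blast
qed

lemma em_adjunction_unique:
  assumes "em_adjunction A N E F u \<beta> \<epsilon>" "em_adjunction A N E F' u \<beta> \<epsilon>'"
  shows "F = F'" "\<epsilon> = \<epsilon>'"
proof -
  have em: "em_object A N E u \<beta>" using assms by (simp add: em_adjunction_def)
  show F: "F = F'"
    by (rule em_object_1cell_eqI[OF em]) (use assms in \<open>auto simp: em_adjunction_def adjunction_def\<close>)
  show "\<epsilon> = \<epsilon>'"
    by (rule em_object_2cell_eqI[OF em]) (use assms F in \<open>auto simp: em_adjunction_def adjunction_def\<close>)
qed

text \<open>
  Puts the monad into the form required by \<open>adjunction_comparison_ex1\<close>, so that the Kleisli
  adjunction, which is the dual case, has a comparison 1-cell.
\<close>

lemma em_adjunction_monad:
  assumes "em_adjunction A N E F u \<beta> \<epsilon>"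
  shows "N = \<lparr>Base = Base N, Endo = u \<odot> F, MUnit = MUnit N, Mult = u \<rhd> (\<epsilon> \<lhd> F)\<rparr>"
proof -
  have "(u \<rhd> \<epsilon>) \<lhd> F = u \<rhd> (\<epsilon> \<lhd> F)"
    by (rule lrwhisk) (use assms in \<open>auto simp: em_adjunction_def adjunction_def\<close>)
  then show ?thesis using assms by (simp add: em_adjunction_def)
qed

text \<open>
  The 1-cell between the two universal algebras is invertible by universality. Compatibility with
  the adjunctions is tested after composition with \<open>u'\<close>, where it becomes \<open>R = R\<close>, \<open>\<mu> = \<mu>\<close> and
  \<open>\<beta> = \<beta>\<close>.
\<close>

lemma em_adjunction_iso:
  assumes E: "em_adjunction A N E F u \<beta> \<epsilon>" and E': "em_adjunction A N E' F' u' \<beta>' \<epsilon>'"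
  obtains g where "iso_1cell A E E' g" "u' \<odot> g = u" "\<beta>' \<lhd> g = \<beta>"
    "g \<odot> F = F'" "g \<rhd> \<epsilon> = \<epsilon>' \<lhd> g"
proof -
  have em: "em_object A N E u \<beta>" and em': "em_object A N E' u' \<beta>'"
    using assms by (auto simp: em_adjunction_def)
  note i = em_object_in[OF em] and i' = em_object_in[OF em']
  have "(u, \<beta>) \<in> Subeq A N E" "(u', \<beta>') \<in> Subeq A N E'"
    using em em' by (auto simp: em_object_def)
  from em_object_1cell_ex1[OF em' this(1)] em_object_1cell_ex1[OF em this(2)] obtain g k where
    g: "g \<in> Hom1 A E E'" "u' \<odot> g = u" "\<beta>' \<lhd> g = \<beta>" and
    k: "k \<in> Hom1 A E' E" "u \<odot> k = u'" "\<beta> \<lhd> k = \<beta>'" by blast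
  have "k \<odot> g = Id1 A E"
    by (rule em_object_1cell_eqI[OF em Comp1_in[OF g(1) k(1)] Id1_in[OF i(1)]])
      (simp_all add: Comp1_assoc[OF g(1) k(1) i(2), symmetric] rwhisk_Comp[OF i(3) k(1) g(1)]
        g k Comp1_Id_right[OF i(2)] rwhisk_Id1[OF i(3)])
  moreover have "g \<odot> k = Id1 A E'"
    by (rule em_object_1cell_eqI[OF em' Comp1_in[OF k(1) g(1)] Id1_in[OF i'(1)]])
      (simp_all add: Comp1_assoc[OF k(1) g(1) i'(2), symmetric] rwhisk_Comp[OF i'(3) g(1) k(1)]
        g k Comp1_Id_right[OF i'(2)] rwhisk_Id1[OF i'(3)])
  ultimately have iso: "iso_1cell A E E' g" using g k by (auto simp: iso_1cell_def)
  have F: "F \<in> Hom1 A (Base N) E" "u \<odot> F = Endo N" "\<beta> \<lhd> F = Mult N"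
    "\<epsilon> \<in> Hom2 A E E (F \<odot> u) (Id1 A E)" "u \<rhd> \<epsilon> = \<beta>"
    and F': "F' \<in> Hom1 A (Base N) E'" "u' \<odot> F' = Endo N" "\<beta>' \<lhd> F' = Mult N"
    "\<epsilon>' \<in> Hom2 A E' E' (F' \<odot> u') (Id1 A E')" "u' \<rhd> \<epsilon>' = \<beta>'"
    using assms by (auto simp: em_adjunction_def adjunction_def)
  have gF: "g \<odot> F = F'"
    by (rule em_object_1cell_eqI[OF em' Comp1_in[OF F(1) g(1)] F'(1)])
      (simp_all add: Comp1_assoc[OF F(1) g(1) i'(2), symmetric] rwhisk_Comp[OF i'(3) g(1) F(1)] g F F')
  have ge: "g \<rhd> \<epsilon> \<in> Hom2 A E E' (F' \<odot> u) g"
    using lwhisk_in[OF F(4) g(1)]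
    by (simp add: Comp1_assoc[OF i(2) F(1) g(1), symmetric] gF Comp1_Id_right[OF g(1)])
  have eg: "\<epsilon>' \<lhd> g \<in> Hom2 A E E' (F' \<odot> u) g"
    using rwhisk_in[OF g(1) F'(4)]
    by (simp add: Comp1_assoc[OF g(1) i'(2) F'(1)] g(2) Comp1_Id_left[OF g(1)])
  have "g \<rhd> \<epsilon> = \<epsilon>' \<lhd> g"
    by (rule em_object_2cell_eqI[OF em' ge eg])
      (simp add: lwhisk_Comp[OF F(4) g(1) i'(2), symmetric] lrwhisk[OF F'(4) g(1) i'(2), symmetric] g F F')
  with that iso g gF show thesis by blast
qed

end


section \<open>Kem-diagrams\<close>

lemma kem_diagram_iff:
  "kem_diagram A D \<longleftrightarrow> is_monad A (monad_of D) \<and>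
    em_adjunction (op1 A) (monad_of D) (Kl D) (KlU D) (KlF D) (Kappa D) (KlCounit D) \<and>
    em_adjunction A (monad_of D) (EM D) (EMF D) (EMU D) (Beta D) (EMCounit D) \<and>
    comparison A (EM D) (EMU D) (Beta D) (Kl D) (KlU D) (KlCounit D) (Cmp D)"
  by (auto simp: kem_diagram_def em_adjunction_def op1_em_object monad_data.defs)

context two_category begin

lemma kem_diagram_ex1:
  assumes mon: "is_monad A N" and kl: "kleisli_object A N L f \<kappa>" and em: "em_object A N E u \<beta>"
  shows "\<exists>!D. kem_diagram A D \<and> monad_of D = N \<and>
    (Kl D, KlF D, Kappa D) = (L, f, \<kappa>) \<and> (EM D, EMU D, Beta D) = (E, u, \<beta>)"
proof -
  interpret op: two_category "op1 A" by (rule op1_two_category)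
  obtain U \<epsilon>L where L: "em_adjunction (op1 A) N L U f \<kappa> \<epsilon>L"
    using op.em_adjunction_exists[of N L f \<kappa>] mon kl by (auto simp: op1_em_object)
  obtain F \<epsilon>E where E: "em_adjunction A N E F u \<beta> \<epsilon>E" using em_adjunction_exists[OF mon em] by blast
  have adj: "adjunction A (Base N) L f U (MUnit N) \<epsilon>L" using L by (simp add: em_adjunction_def)
  have "f \<in> Hom1 A (Base N) L" "U \<in> Hom1 A L (Base N)"
    "\<epsilon>L \<in> Hom2 A L L (f \<odot> U) (Id1 A L)" using adj by (auto simp: adjunction_def)
  then have "N = \<lparr>Base = Base N, Endo = U \<odot> f, MUnit = MUnit N, Mult = U \<rhd> (\<epsilon>L \<lhd> f)\<rparr>"
    using op.em_adjunction_monad[OF L] lrwhisk by simp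
  then obtain J where J: "comparison A E u \<beta> L U \<epsilon>L J"
    and J1: "\<And>J'. comparison A E u \<beta> L U \<epsilon>L J' \<Longrightarrow> J' = J"
    using adjunction_comparison_ex1[OF adj em] by blast
  define D where "D = \<lparr>Base = Base N, Endo = Endo N, MUnit = MUnit N, Mult = Mult N,
    Kl = L, KlF = f, KlU = U, Kappa = \<kappa>, KlCounit = \<epsilon>L,
    EM = E, EMF = F, EMU = u, Beta = \<beta>, EMCounit = \<epsilon>E, Cmp = J\<rparr>"
  have ND: "monad_of D = N" by (simp add: D_def monad_data.defs)
  show ?thesis
  proof (rule ex1I[of _ D])
    show "kem_diagram A D \<and> monad_of D = N \<and>
      (Kl D, KlF D, Kappa D) = (L, f, \<kappa>) \<and> (EM D, EMU D, Beta D) = (E, u, \<beta>)"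
      unfolding kem_diagram_iff ND using mon L E J by (simp add: D_def)
  next
    fix D' assume D': "kem_diagram A D' \<and> monad_of D' = N \<and>
      (Kl D', KlF D', Kappa D') = (L, f, \<kappa>) \<and> (EM D', EMU D', Beta D') = (E, u, \<beta>)"
    then have L': "em_adjunction (op1 A) N L (KlU D') f \<kappa> (KlCounit D')"
      and E': "em_adjunction A N E (EMF D') u \<beta> (EMCounit D')"
      and J': "comparison A E u \<beta> L (KlU D') (KlCounit D') (Cmp D')"
      by (auto simp: kem_diagram_iff)
    have "KlU D' = U" "KlCounit D' = \<epsilon>L" using op.em_adjunction_unique[OF L' L] by auto
    moreover have "EMF D' = F" "EMCounit D' = \<epsilon>E" using em_adjunction_unique[OF E' E] by auto
    ultimately show "D' = D"
      using D' J1 J' ND by (auto simp: D_def monad_data.defs intro!: kem_data.equality)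
  qed
qed

text \<open>
  The Kleisli part of the isomorphism comes from \<open>em_adjunction_iso\<close> with reversed 1-cells, which is
  why the two diagrams are exchanged there. Compatibility with the comparison 1-cells is checked on
  the subequalizings that they classify.
\<close>

lemma kem_iso_ex1:
  assumes D: "kem_diagram A D" and D': "kem_diagram A D'" and m: "monad_of D = monad_of D'"
  shows "\<exists>!hg. kem_iso A D D' (fst hg) (snd hg)"
proof -
  interpret op: two_category "op1 A" by (rule op1_two_category)
  define N where "N = monad_of D"
  have L: "em_adjunction (op1 A) N (Kl D) (KlU D) (KlF D) (Kappa D) (KlCounit D)"
    and L': "em_adjunction (op1 A) N (Kl D') (KlU D') (KlF D') (Kappa D') (KlCounit D')"
    and E: "em_adjunction A N (EM D) (EMF D) (EMU D) (Beta D) (EMCounit D)"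
    and E': "em_adjunction A N (EM D') (EMF D') (EMU D') (Beta D') (EMCounit D')"
    and J: "comparison A (EM D) (EMU D) (Beta D) (Kl D) (KlU D) (KlCounit D) (Cmp D)"
    and J': "comparison A (EM D') (EMU D') (Beta D') (Kl D') (KlU D') (KlCounit D') (Cmp D')"
    using D D' m by (auto simp: kem_diagram_iff N_def)
  have emL: "em_object (op1 A) N (Kl D) (KlF D) (Kappa D)"
    and emE': "em_object A N (EM D') (EMU D') (Beta D')"
    using L E' by (auto simp: em_adjunction_def)
  obtain h where h: "iso_1cell A (Kl D) (Kl D') h" "h \<odot> KlF D = KlF D'" "h \<rhd> Kappa D = Kappa D'"
    "KlU D' \<odot> h = KlU D" "KlCounit D' \<lhd> h = h \<rhd> KlCounit D"
    using op.em_adjunction_iso[OF L' L] by auto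
  obtain g where g: "iso_1cell A (EM D) (EM D') g" "EMU D' \<odot> g = EMU D" "Beta D' \<lhd> g = Beta D"
    "g \<odot> EMF D = EMF D'" "g \<rhd> EMCounit D = EMCounit D' \<lhd> g"
    using em_adjunction_iso[OF E E'] by auto
  have h1: "h \<in> Hom1 A (Kl D) (Kl D')" and g1: "g \<in> Hom1 A (EM D) (EM D')"
    using h g by (auto simp: iso_1cell_def)
  have J1: "Cmp D \<in> Hom1 A (Kl D) (EM D)" "EMU D \<odot> Cmp D = KlU D"
      "Beta D \<lhd> Cmp D = KlU D \<rhd> KlCounit D"
    and J1': "Cmp D' \<in> Hom1 A (Kl D') (EM D')" "EMU D' \<odot> Cmp D' = KlU D'"
      "Beta D' \<lhd> Cmp D' = KlU D' \<rhd> KlCounit D'"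
    using J J' by (auto simp: comparison_def)
  note i' = em_object_in[OF emE']
  have e: "KlCounit D \<in> Hom2 A (Kl D) (Kl D) (KlF D \<odot> KlU D) (Id1 A (Kl D))"
    "KlCounit D' \<in> Hom2 A (Kl D') (Kl D') (KlF D' \<odot> KlU D') (Id1 A (Kl D'))"
    "KlU D' \<in> Hom1 A (Kl D') (Base N)"
    using L L' by (auto simp: em_adjunction_def adjunction_def)
  have "g \<odot> Cmp D = Cmp D' \<odot> h"
  proof (rule em_object_1cell_eqI[OF emE' Comp1_in[OF J1(1) g1] Comp1_in[OF h1 J1'(1)]])
    show "EMU D' \<odot> (g \<odot> Cmp D) = EMU D' \<odot> (Cmp D' \<odot> h)"
      by (simp add: Comp1_assoc[OF J1(1) g1 i'(2), symmetric]
          Comp1_assoc[OF h1 J1'(1) i'(2), symmetric] g h J1 J1')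
    show "Beta D' \<lhd> (g \<odot> Cmp D) = Beta D' \<lhd> (Cmp D' \<odot> h)"
      by (simp add: rwhisk_Comp[OF i'(3) g1 J1(1)] rwhisk_Comp[OF i'(3) J1'(1) h1] g(3) J1(3) J1'(3)
          lrwhisk[OF e(2) h1 e(3)] h(5) lwhisk_Comp[OF e(1) h1 e(3), symmetric] h(4))
  qed
  then have iso: "kem_iso A D D' h g" using h g by (simp add: kem_iso_def)
  show ?thesis
  proof (rule ex1I[of _ "(h, g)"])
    show "kem_iso A D D' (fst (h, g)) (snd (h, g))" using iso by simp
  next
    fix x assume x: "kem_iso A D D' (fst x) (snd x)"
    have "fst x = h"
      by (rule op.em_object_1cell_eqI[OF emL]) (use x h1 h in \<open>auto simp: kem_iso_def iso_1cell_def\<close>)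
    moreover have "snd x = g"
      by (rule em_object_1cell_eqI[OF emE']) (use x g1 g in \<open>auto simp: kem_iso_def iso_1cell_def\<close>)
    ultimately show "x = (h, g)" by (simp add: prod_eq_iff)
  qed
qed

end


section \<open>The coequalizer defining the leg of the Eilenberg--Moore object\<close>

text \<open>
  The monad of an adjunction \<open>r \<stileturn> U\<close> with an Eilenberg--Moore object \<open>(E, u, \<beta>)\<close> and its
  adjunction \<open>(F \<stileturn> u, \<eta>, e)\<close>.
\<close>

locale adjunction_em = two_category A for A :: "('o, 'm, 'c) two_cat" (structure) +
  fixes M C E :: 'o and r U F u :: 'm and \<eta> \<epsilon> \<beta> e :: 'c
  assumes adj: "adjunction A C M r U \<eta> \<epsilon>"
    and em_adj: "em_adjunction A \<lparr>Base = C, Endo = U \<odot> r, MUnit = \<eta>, Mult = U \<rhd> (\<epsilon> \<lhd> r)\<rparr> E F u \<beta> e"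
begin

abbreviation R where "R \<equiv> U \<odot> r"
abbreviation \<mu> where "\<mu> \<equiv> U \<rhd> (\<epsilon> \<lhd> r)"
abbreviation N where "N \<equiv> \<lparr>Base = C, Endo = R, MUnit = \<eta>, Mult = \<mu>\<rparr>"

lemma em: "em_object A N E u \<beta>"
  and F_adj_u: "adjunction A C E F u \<eta> e"
  and uF: "u \<odot> F = R" and \<beta>F: "\<beta> \<lhd> F = \<mu>" and ue: "u \<rhd> e = \<beta>"
  using em_adj by (auto simp: em_adjunction_def)

lemma r: "r \<in> Hom1 A C M" and U: "U \<in> Hom1 A M C"
  and F: "F \<in> Hom1 A C E" and u: "u \<in> Hom1 A E C" and R: "R \<in> Hom1 A C C"
  and ru: "r \<odot> u \<in> Hom1 A E M"
  using adj F_adj_u Comp1_in by (auto simp: adjunction_def)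

lemma Obj: "C \<in> Obj A" "M \<in> Obj A" "E \<in> Obj A"
  using Hom1_Obj r u by auto

lemma \<eta>: "\<eta> \<in> Hom2 A C C (Id1 A C) R" and \<epsilon>: "\<epsilon> \<in> Hom2 A M M (r \<odot> U) (Id1 A M)"
  and e: "e \<in> Hom2 A E E (F \<odot> u) (Id1 A E)"
  and tri_r: "(\<epsilon> \<lhd> r) \<bullet> (r \<rhd> \<eta>) = Id2 A r" and tri_U: "(U \<rhd> \<epsilon>) \<bullet> (\<eta> \<lhd> U) = Id2 A U"
  using adj F_adj_u by (auto simp: adjunction_def)

lemma \<beta>: "\<beta> \<in> Hom2 A E C (R \<odot> u) u"
  and \<beta>_unit: "\<beta> \<bullet> (\<eta> \<lhd> u) = Id2 A u"
  using em_object_in[OF em] by auto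

lemma \<epsilon>r: "\<epsilon> \<lhd> r \<in> Hom2 A C M (r \<odot> R) r"
  using rwhisk_in[OF r \<epsilon>] by (simp add: Comp1_Id_left[OF r] Comp1_assoc[OF r U r])

lemma r\<eta>: "r \<rhd> \<eta> \<in> Hom2 A C M r (r \<odot> R)"
  using lwhisk_in[OF \<eta> r] by (simp add: Comp1_Id_right[OF r])

lemma \<eta>u: "\<eta> \<lhd> u \<in> Hom2 A E C u (R \<odot> u)"
  using rwhisk_in[OF u \<eta>] by (simp add: Comp1_Id_left[OF u])

lemma \<mu>: "\<mu> \<in> Hom2 A C C (R \<odot> R) R"
  using lwhisk_in[OF \<epsilon>r U] by (simp add: Comp1_assoc[OF R r U])

lemma monad: "is_monad A N"
  by (rule adjunction_is_monad[OF adj])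

lemma \<mu>_unit: "\<mu> \<bullet> (R \<rhd> \<eta>) = Id2 A R" "\<mu> \<bullet> (\<eta> \<lhd> R) = Id2 A R"
  using monad by (simp_all add: is_monad_def Let_def)

text \<open>
  Thus \<open>(r, \<epsilon>\<^sub>r)\<close> is a subcoequalizing, by the dual of \<open>adjunction_action\<close>.
\<close>

lemma \<epsilon>r_action: "(\<epsilon> \<lhd> r) \<bullet> (r \<rhd> \<mu>) = (\<epsilon> \<lhd> r) \<bullet> ((\<epsilon> \<lhd> r) \<lhd> R)"
proof -
  interpret op: two_category "op1 A" by (rule op1_two_category)
  show ?thesis
    using op.adjunction_action(1)[of C M U r \<eta> \<epsilon>] adj by (simp add: lrwhisk[OF \<epsilon> r U])
qed

text \<open>
  The parallel pair is used in the form \<open>r(\<beta>)\<close>, \<open>(\<epsilon>\<^sub>r)\<^sub>u\<close>, which refers to the algebra \<open>(u, \<beta>)\<close>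
  only. Whiskering with \<open>k\<close> then gives the same pair for the algebra \<open>(u k, \<beta>\<^sub>k)\<close>.
\<close>

lemma pair_left: "(r \<odot> u) \<rhd> e = r \<rhd> \<beta>"
  using lwhisk_Comp[OF e u r] by (simp add: ue)

lemma pair_right: "\<epsilon> \<lhd> (r \<odot> u) = (\<epsilon> \<lhd> r) \<lhd> u"
  by (rule rwhisk_Comp[OF \<epsilon> r u])

lemma pair_in: "r \<rhd> \<beta> \<in> Hom2 A E M (r \<odot> (R \<odot> u)) (r \<odot> u)"
  "(\<epsilon> \<lhd> r) \<lhd> u \<in> Hom2 A E M (r \<odot> (R \<odot> u)) (r \<odot> u)"
  using lwhisk_in[OF \<beta> r] rwhisk_in[OF u \<epsilon>r] by (simp_all add: Comp1_assoc[OF u R r])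

lemma section_in: "r \<rhd> (\<eta> \<lhd> u) \<in> Hom2 A E M (r \<odot> u) (r \<odot> (R \<odot> u))"
  by (rule lwhisk_in[OF \<eta>u r])

lemma section_left: "(r \<rhd> \<beta>) \<bullet> (r \<rhd> (\<eta> \<lhd> u)) = Id2 A (r \<odot> u)"
  using lwhisk_VComp[OF \<eta>u \<beta> r] by (simp add: \<beta>_unit lwhisk_Id2[OF u r])

lemma section_right: "((\<epsilon> \<lhd> r) \<lhd> u) \<bullet> (r \<rhd> (\<eta> \<lhd> u)) = Id2 A (r \<odot> u)"
  using rwhisk_VComp[OF r\<eta> \<epsilon>r u] by (simp add: tri_r rwhisk_Id2[OF u r] lrwhisk[OF \<eta> u r])

lemma pair_reflexive:
  "reflexive_pair A E M (r \<odot> (U \<odot> r) \<odot> u) (r \<odot> u) ((r \<odot> u) \<rhd> e) (\<epsilon> \<lhd> (r \<odot> u))"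
  using pair_in section_in section_left section_right
  by (auto simp: reflexive_pair_def pair_left pair_right)

end

locale em_coequalizer = adjunction_em +
  fixes s q
  assumes rc: "rc_0cell A M"
    and coeq: "is_coequalizer A E M (r \<odot> (U \<odot> r) \<odot> u) (r \<odot> u) ((r \<odot> u) \<rhd> e) (\<epsilon> \<lhd> (r \<odot> u)) s q"
begin

lemma q: "q \<in> Hom2 A E M (r \<odot> u) s" and q_coeq: "q \<bullet> (r \<rhd> \<beta>) = q \<bullet> ((\<epsilon> \<lhd> r) \<lhd> u)"
  using coeq by (auto simp: is_coequalizer_def pair_left pair_right)

lemma s: "s \<in> Hom1 A E M"
  using q Hom2_Hom1 by blast

lemma q_whisk_in:
  assumes k: "k \<in> Hom1 A X E" and v: "u \<odot> k = v"
  shows "q \<lhd> k \<in> Hom2 A X M (r \<odot> v) (s \<odot> k)"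
  using rwhisk_in[OF k q] by (simp add: Comp1_assoc[OF k u r] v)

lemma q_whisk_coeq:
  assumes k: "k \<in> Hom1 A X E" and v: "u \<odot> k = v" "\<beta> \<lhd> k = \<nu>"
  shows "(q \<lhd> k) \<bullet> (r \<rhd> \<nu>) = (q \<lhd> k) \<bullet> ((\<epsilon> \<lhd> r) \<lhd> v)"
  using arg_cong[OF q_coeq, of "\<lambda>t. t \<lhd> k"]
  by (simp add: rwhisk_VComp[OF pair_in(1) q k] rwhisk_VComp[OF pair_in(2) q k] lrwhisk[OF \<beta> k r]
      rwhisk_Comp[OF \<epsilon>r u k, symmetric] v)

text \<open>
  The universal property of the coequalizer whiskered with \<open>k\<close>, available because precomposition
  preserves reflexive coequalizers in \<open>\<A>(-, M)\<close>. Its data depend on \<open>k\<close> only through the algebra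
  \<open>(v, \<nu>)\<close> classified by \<open>k\<close>.
\<close>

lemma q_descent:
  assumes k: "k \<in> Hom1 A X E" and v: "u \<odot> k = v" "\<beta> \<lhd> k = \<nu>"
    and \<theta>: "\<theta> \<in> Hom2 A X M (r \<odot> v) x" "\<theta> \<bullet> (r \<rhd> \<nu>) = \<theta> \<bullet> ((\<epsilon> \<lhd> r) \<lhd> v)"
  shows "\<exists>!\<theta>'. \<theta>' \<in> Hom2 A X M (s \<odot> k) x \<and> \<theta>' \<bullet> (q \<lhd> k) = \<theta>"
proof -
  have X: "X \<in> Obj A" using Hom1_Obj[OF k] by simp
  have "is_coequalizer A X M ((r \<odot> (U \<odot> r) \<odot> u) \<odot> k) ((r \<odot> u) \<odot> k)
      (((r \<odot> u) \<rhd> e) \<lhd> k) ((\<epsilon> \<lhd> (r \<odot> u)) \<lhd> k) (s \<odot> k) (q \<lhd> k)"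
    using rc X Obj k pair_reflexive coeq unfolding rc_0cell_def by blast
  moreover have "((r \<odot> u) \<rhd> e) \<lhd> k = r \<rhd> \<nu>" "(\<epsilon> \<lhd> (r \<odot> u)) \<lhd> k = (\<epsilon> \<lhd> r) \<lhd> v"
    using lrwhisk[OF \<beta> k r] rwhisk_Comp[OF \<epsilon>r u k] by (simp_all add: pair_left pair_right v)
  ultimately show ?thesis using \<theta> by (simp add: is_coequalizer_def Comp1_assoc[OF k u r] v)
qed

lemma q_whisk_epi:
  assumes k: "k \<in> Hom1 A X E"
    and \<theta>: "\<theta> \<in> Hom2 A X M (s \<odot> k) x" "\<theta>' \<in> Hom2 A X M (s \<odot> k) x"
    and eq: "\<theta> \<bullet> (q \<lhd> k) = \<theta>' \<bullet> (q \<lhd> k)"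
  shows "\<theta> = \<theta>'"
proof -
  note qk = q_whisk_in[OF k refl]
  note uk = Comp1_in[OF k u]
  note a = lwhisk_in[OF rwhisk_in[OF k \<beta>] r] and b = rwhisk_in[OF uk \<epsilon>r]
  have b': "(\<epsilon> \<lhd> r) \<lhd> (u \<odot> k) \<in> Hom2 A X M (r \<odot> ((R \<odot> u) \<odot> k)) (r \<odot> (u \<odot> k))"
    using b by (simp add: Comp1_assoc[OF uk R r] Comp1_assoc[OF k u R])
  have "(\<theta> \<bullet> (q \<lhd> k)) \<bullet> (r \<rhd> (\<beta> \<lhd> k)) = (\<theta> \<bullet> (q \<lhd> k)) \<bullet> ((\<epsilon> \<lhd> r) \<lhd> (u \<odot> k))"
    by (simp add: VComp_assoc[OF a qk \<theta>(1)] VComp_assoc[OF b' qk \<theta>(1)] q_whisk_coeq[OF k refl refl])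
  from q_descent[OF k refl refl VComp_in[OF qk \<theta>(1)] this] \<theta> eq show ?thesis by auto
qed

text \<open>
  For \<open>k = F\<close> the algebra is \<open>(R, \<mu>)\<close>, whose pair is coequalized by \<open>\<epsilon>\<^sub>r\<close>.
\<close>

lemma v_ex1: "\<exists>!v. v \<in> Hom2 A C M (s \<odot> F) r \<and> v \<bullet> (q \<lhd> F) = \<epsilon> \<lhd> r"
  by (rule q_descent[OF F uF \<beta>F \<epsilon>r \<epsilon>r_action])

abbreviation v_inv where "v_inv \<equiv> (q \<lhd> F) \<bullet> (r \<rhd> \<eta>)"

text \<open>
  The fork \<open>\<epsilon>\<^sub>r : r R \<rightarrow> r\<close> is split by \<open>r(\<eta>)\<close>, so it is itself a coequalizer of the pair that
  \<open>q\<^sub>F\<close> coequalizes. The inverse of the comparison is \<open>q\<^sub>F\<close> composed with the splitting.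
\<close>

lemma v_inverse:
  assumes v: "v \<in> Hom2 A C M (s \<odot> F) r" "v \<bullet> (q \<lhd> F) = \<epsilon> \<lhd> r"
  shows "inverse_2cells A C M (s \<odot> F) r v v_inv"
proof -
  note qF = q_whisk_in[OF F uF]
  note v_inv_in = VComp_in[OF r\<eta> qF]
  have 1: "v \<bullet> v_inv = Id2 A r"
    using VComp_assoc[OF r\<eta> qF v(1)] by (simp add: v tri_r)
  have t1: "(\<epsilon> \<lhd> r) \<lhd> R \<in> Hom2 A C M (r \<odot> (R \<odot> R)) (r \<odot> R)"
    using rwhisk_in[OF R \<epsilon>r] by (simp add: Comp1_assoc[OF R R r])
  have t2: "r \<rhd> (R \<rhd> \<eta>) \<in> Hom2 A C M (r \<odot> R) (r \<odot> (R \<odot> R))"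
    using lwhisk_in[OF lwhisk_in[OF \<eta> R] r] by (simp add: Comp1_Id_right[OF R])
  have R\<eta>: "R \<rhd> \<eta> \<in> Hom2 A C C R (R \<odot> R)"
    using lwhisk_in[OF \<eta> R] by (simp add: Comp1_Id_right[OF R])
  have "(v_inv \<bullet> v) \<bullet> (q \<lhd> F) = v_inv \<bullet> (\<epsilon> \<lhd> r)"
    using VComp_assoc[OF qF v(1) v_inv_in] by (simp add: v)
  also have "\<dots> = (q \<lhd> F) \<bullet> ((r \<rhd> \<eta>) \<bullet> (\<epsilon> \<lhd> r))" by (rule VComp_assoc[OF \<epsilon>r r\<eta> qF])
  also have "(r \<rhd> \<eta>) \<bullet> (\<epsilon> \<lhd> r) = ((\<epsilon> \<lhd> r) \<lhd> R) \<bullet> (r \<rhd> (R \<rhd> \<eta>))"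
    using whisker_swap[OF \<eta> \<epsilon>r] by (simp add: rwhisk_Id1[OF \<epsilon>r] lwhisk_Comp[OF \<eta> R r])
  also have "(q \<lhd> F) \<bullet> \<dots> = ((q \<lhd> F) \<bullet> ((\<epsilon> \<lhd> r) \<lhd> R)) \<bullet> (r \<rhd> (R \<rhd> \<eta>))"
    by (rule VComp_assoc[OF t2 t1 qF, symmetric])
  also have "(q \<lhd> F) \<bullet> ((\<epsilon> \<lhd> r) \<lhd> R) = (q \<lhd> F) \<bullet> (r \<rhd> \<mu>)"
    using q_whisk_coeq[OF F uF \<beta>F] by simp
  also have "\<dots> \<bullet> (r \<rhd> (R \<rhd> \<eta>)) = (q \<lhd> F) \<bullet> ((r \<rhd> \<mu>) \<bullet> (r \<rhd> (R \<rhd> \<eta>)))"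
    by (rule VComp_assoc[OF t2 lwhisk_in[OF \<mu> r] qF])
  also have "(r \<rhd> \<mu>) \<bullet> (r \<rhd> (R \<rhd> \<eta>)) = Id2 A (r \<odot> R)"
    using lwhisk_VComp[OF R\<eta> \<mu> r] by (simp add: \<mu>_unit lwhisk_Id2[OF R r])
  also have "(q \<lhd> F) \<bullet> Id2 A (r \<odot> R) = q \<lhd> F" by (rule VComp_Id_right[OF qF])
  finally have "(v_inv \<bullet> v) \<bullet> (q \<lhd> F) = Id2 A (s \<odot> F) \<bullet> (q \<lhd> F)"
    by (simp add: VComp_Id_left[OF qF])
  then have "v_inv \<bullet> v = Id2 A (s \<odot> F)"
    by (rule q_whisk_epi[OF F VComp_in[OF v(1) v_inv_in] Id2_in[OF Comp1_in[OF F s]]])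
  then show ?thesis using 1 v v_inv_in by (simp add: inverse_2cells_def)
qed

text \<open>
  Interchanging \<open>q\<close> with \<open>e\<close> turns the left-hand side into \<open>q \<circ> r(\<beta>) \<circ> r(\<eta>\<^sub>u)\<close>, and
  \<open>\<beta> \<circ> \<eta>\<^sub>u\<close> is an identity.
\<close>

lemma leg_of_u: "(s \<rhd> e) \<bullet> (v_inv \<lhd> u) = q"
proof -
  note qF = q_whisk_in[OF F uF]
  have t1: "(q \<lhd> F) \<lhd> u \<in> Hom2 A E M (r \<odot> (R \<odot> u)) ((s \<odot> F) \<odot> u)"
    using rwhisk_in[OF u qF] by (simp add: Comp1_assoc[OF u R r])
  have t2: "s \<rhd> e \<in> Hom2 A E M ((s \<odot> F) \<odot> u) s"
    using lwhisk_in[OF e s] by (simp add: Comp1_assoc[OF u F s] Comp1_Id_right[OF s])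
  have "v_inv \<lhd> u = ((q \<lhd> F) \<lhd> u) \<bullet> (r \<rhd> (\<eta> \<lhd> u))"
    using rwhisk_VComp[OF r\<eta> qF u] by (simp add: lrwhisk[OF \<eta> u r])
  then have "(s \<rhd> e) \<bullet> (v_inv \<lhd> u) = ((s \<rhd> e) \<bullet> ((q \<lhd> F) \<lhd> u)) \<bullet> (r \<rhd> (\<eta> \<lhd> u))"
    using VComp_assoc[OF section_in t1 t2] by simp
  also have "(s \<rhd> e) \<bullet> ((q \<lhd> F) \<lhd> u) = q \<bullet> (r \<rhd> \<beta>)"
    using whisker_swap[OF e q] by (simp add: rwhisk_Id1[OF q] rwhisk_Comp[OF q F u] pair_left)
  also have "\<dots> \<bullet> (r \<rhd> (\<eta> \<lhd> u)) = q"
    using VComp_assoc[OF section_in pair_in(1) q] by (simp add: section_left VComp_Id_right[OF q])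
  finally show ?thesis .
qed

text \<open>
  By \<open>q_descent\<close>, by transposition along \<open>r \<stileturn> U\<close> and by the universal property of \<open>E\<close>, 2-cells
  \<open>s k \<rightarrow> x\<close> correspond to 2-cells \<open>k \<rightarrow> K x\<close>. The unit corresponds to the identity of \<open>s\<close>, so that
  \<open>u\<close> sends it to the transpose \<open>\<sigma>\<close> of \<open>q\<close>; the counit corresponds to the identity of \<open>K\<close>, so that
  its composite with \<open>q\<^sub>K\<close> is the transpose \<open>\<epsilon>\<close> of the identity of \<open>U\<close>. The triangle identities
  are tested after applying the faithful \<open>u\<close> and after composing with the epimorphism \<open>q\<close>.
\<close>

lemma leg_left_adjoint:
  assumes cmp: "comparison A E u \<beta> M U \<epsilon> K"
  shows "\<exists>\<eta>' \<epsilon>'. adjunction A E M s K \<eta>' \<epsilon>'"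
proof -
  have K: "K \<in> Hom1 A M E" "u \<odot> K = U" "\<beta> \<lhd> K = U \<rhd> \<epsilon>" using cmp by (auto simp: comparison_def)
  note Us = Comp1_in[OF s U] and Ks = Comp1_in[OF s K(1)] and sK = Comp1_in[OF K(1) s]
  note rU = Comp1_in[OF U r]
  have uKs: "u \<odot> (K \<odot> s) = U \<odot> s" using Comp1_assoc[OF s K(1) u] by (simp add: K)
  have \<beta>Ks: "\<beta> \<lhd> (K \<odot> s) = U \<rhd> (\<epsilon> \<lhd> s)"
    using rwhisk_Comp[OF \<beta> K(1) s] lrwhisk[OF \<epsilon> s U] by (simp add: K)
  have Uq: "U \<rhd> q \<in> Hom2 A E C (R \<odot> u) (U \<odot> s)"
    using lwhisk_in[OF q U] by (simp add: Comp1_assoc[OF u r U])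
  define \<sigma> where "\<sigma> = (U \<rhd> q) \<bullet> (\<eta> \<lhd> u)"
  have \<sigma>: "\<sigma> \<in> Hom2 A E C u (U \<odot> s)" unfolding \<sigma>_def by (rule VComp_in[OF \<eta>u Uq])
  have \<epsilon>s: "\<epsilon> \<lhd> s \<in> Hom2 A E M (r \<odot> (U \<odot> s)) s"
    using rwhisk_in[OF s \<epsilon>] by (simp add: Comp1_Id_left[OF s] Comp1_assoc[OF s U r])
  have rUq: "r \<rhd> (U \<rhd> q) \<in> Hom2 A E M (r \<odot> (R \<odot> u)) (r \<odot> (U \<odot> s))" by (rule lwhisk_in[OF Uq r])
  have "(\<epsilon> \<lhd> s) \<bullet> (r \<rhd> (U \<rhd> q)) = q \<bullet> ((\<epsilon> \<lhd> r) \<lhd> u)"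
    using whisker_swap[OF q \<epsilon>] by (simp add: lwhisk_Id1[OF q] lwhisk_Comp[OF q U r] pair_right)
  \<comment> \<open>Transposing \<open>\<sigma>\<close> back along \<open>r \<stileturn> U\<close> returns \<open>q\<close>.\<close>
  then have tr: "(\<epsilon> \<lhd> s) \<bullet> (r \<rhd> \<sigma>) = q"
    unfolding \<sigma>_def lwhisk_VComp[OF \<eta>u Uq r]
    using VComp_assoc[OF section_in rUq \<epsilon>s] VComp_assoc[OF section_in pair_in(2) q]
    by (simp add: section_right VComp_Id_right[OF q])
  \<comment> \<open>Hence \<open>\<sigma>\<close> is a morphism of algebras from \<open>(u, \<beta>)\<close> to \<open>(U s, U(\<epsilon>\<^sub>s))\<close>: both sides equal \<open>U(q)\<close>.\<close>
  have alg: "\<sigma> \<bullet> \<beta> = (U \<rhd> (\<epsilon> \<lhd> s)) \<bullet> (R \<rhd> \<sigma>)"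
  proof -
    have R\<beta>: "R \<rhd> \<beta> \<in> Hom2 A E C (R \<odot> (R \<odot> u)) (R \<odot> u)" by (rule lwhisk_in[OF \<beta> R])
    have \<mu>u: "\<mu> \<lhd> u \<in> Hom2 A E C (R \<odot> (R \<odot> u)) (R \<odot> u)"
      using rwhisk_in[OF u \<mu>] by (simp add: Comp1_assoc[OF u R R])
    have \<eta>Ru: "\<eta> \<lhd> (R \<odot> u) \<in> Hom2 A E C (R \<odot> u) (R \<odot> (R \<odot> u))"
      using rwhisk_in[OF Comp1_in[OF u R] \<eta>] by (simp add: Comp1_Id_left[OF Comp1_in[OF u R]])
    have "\<sigma> \<bullet> \<beta> = (U \<rhd> q) \<bullet> ((\<eta> \<lhd> u) \<bullet> \<beta>)"
      unfolding \<sigma>_def by (rule VComp_assoc[OF \<beta> \<eta>u Uq])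
    also have "(\<eta> \<lhd> u) \<bullet> \<beta> = (R \<rhd> \<beta>) \<bullet> (\<eta> \<lhd> (R \<odot> u))"
      using whisker_swap[OF \<beta> \<eta>] by (simp add: lwhisk_Id1[OF \<beta>])
    also have "(U \<rhd> q) \<bullet> \<dots> = ((U \<rhd> q) \<bullet> (R \<rhd> \<beta>)) \<bullet> (\<eta> \<lhd> (R \<odot> u))"
      by (rule VComp_assoc[OF \<eta>Ru R\<beta> Uq, symmetric])
    also have "(U \<rhd> q) \<bullet> (R \<rhd> \<beta>) = (U \<rhd> q) \<bullet> (\<mu> \<lhd> u)"
      using lwhisk_VComp[OF pair_in(1) q U] lwhisk_VComp[OF pair_in(2) q U]
      by (simp add: q_coeq lwhisk_Comp[OF \<beta> r U] lrwhisk[OF \<epsilon>r u U])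
    also have "\<dots> \<bullet> (\<eta> \<lhd> (R \<odot> u)) = (U \<rhd> q) \<bullet> ((\<mu> \<lhd> u) \<bullet> (\<eta> \<lhd> (R \<odot> u)))"
      by (rule VComp_assoc[OF \<eta>Ru \<mu>u Uq])
    also have "(\<mu> \<lhd> u) \<bullet> (\<eta> \<lhd> (R \<odot> u)) = Id2 A (R \<odot> u)"
    proof -
      have \<eta>R: "\<eta> \<lhd> R \<in> Hom2 A C C R (R \<odot> R)"
        using rwhisk_in[OF R \<eta>] by (simp add: Comp1_Id_left[OF R])
      show ?thesis using rwhisk_VComp[OF \<eta>R \<mu> u]
        by (simp add: \<mu>_unit rwhisk_Comp[OF \<eta> R u] rwhisk_Id2[OF u R])
    qed
    also have "(U \<rhd> q) \<bullet> Id2 A (R \<odot> u) = U \<rhd> q" by (rule VComp_Id_right[OF Uq])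
    also have "\<dots> = (U \<rhd> (\<epsilon> \<lhd> s)) \<bullet> (U \<rhd> (r \<rhd> \<sigma>))"
      using lwhisk_VComp[OF lwhisk_in[OF \<sigma> r] \<epsilon>s U] by (simp add: tr)
    finally show ?thesis by (simp add: lwhisk_Comp[OF \<sigma> r U])
  qed
  have idE: "u \<odot> Id1 A E = u" "\<beta> \<lhd> Id1 A E = \<beta>"
    using Comp1_Id_right[OF u] rwhisk_Id1[OF \<beta>] by simp_all
  have "\<exists>!\<tau>. \<tau> \<in> Hom2 A E E (Id1 A E) (K \<odot> s) \<and> u \<rhd> \<tau> = \<sigma>"
    by (rule em_object_2cell_ex1[OF em Id1_in[OF Obj(3)] Ks]) (simp_all add: idE uKs \<beta>Ks \<sigma> alg)
  then obtain n where n: "n \<in> Hom2 A E E (Id1 A E) (K \<odot> s)" "u \<rhd> n = \<sigma>" by blast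
  note qK = q_whisk_in[OF K(1,2)]
  have "\<exists>!\<theta>'. \<theta>' \<in> Hom2 A M M (s \<odot> K) (Id1 A M) \<and> \<theta>' \<bullet> (q \<lhd> K) = \<epsilon>"
    by (rule q_descent[OF K \<epsilon>])
      (use adjunction_action(3)[OF adj] in \<open>simp add: lwhisk_Comp[OF \<epsilon> U r] rwhisk_Comp[OF \<epsilon> r U]\<close>)
  then obtain c where c: "c \<in> Hom2 A M M (s \<odot> K) (Id1 A M)" "c \<bullet> (q \<lhd> K) = \<epsilon>" by blast
  have Kc: "K \<rhd> c \<in> Hom2 A M E ((K \<odot> s) \<odot> K) K"
    using lwhisk_in[OF c(1) K(1)] by (simp add: Comp1_assoc[OF K(1) s K(1)] Comp1_Id_right[OF K(1)])
  have nK: "n \<lhd> K \<in> Hom2 A M E K ((K \<odot> s) \<odot> K)"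
    using rwhisk_in[OF K(1) n(1)] by (simp add: Comp1_Id_left[OF K(1)])
  have tri2: "(K \<rhd> c) \<bullet> (n \<lhd> K) = Id2 A K"
  proof (rule em_object_2cell_eqI[OF em VComp_in[OF nK Kc] Id2_in[OF K(1)]])
    have \<eta>U: "\<eta> \<lhd> U \<in> Hom2 A M C U (R \<odot> U)"
      using rwhisk_in[OF U \<eta>] by (simp add: Comp1_Id_left[OF U])
    have UqK: "U \<rhd> (q \<lhd> K) \<in> Hom2 A M C (R \<odot> U) (U \<odot> (s \<odot> K))"
      using lwhisk_in[OF qK U] by (simp add: Comp1_assoc[OF U r U])
    have Uc: "U \<rhd> c \<in> Hom2 A M C (U \<odot> (s \<odot> K)) U"
      using lwhisk_in[OF c(1) U] by (simp add: Comp1_Id_right[OF U])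
    have "u \<rhd> ((K \<rhd> c) \<bullet> (n \<lhd> K)) = (u \<rhd> (K \<rhd> c)) \<bullet> (u \<rhd> (n \<lhd> K))"
      by (rule lwhisk_VComp[OF nK Kc u])
    also have "u \<rhd> (K \<rhd> c) = U \<rhd> c"
      using lwhisk_Comp[OF c(1) K(1) u] by (simp add: K)
    also have "u \<rhd> (n \<lhd> K) = \<sigma> \<lhd> K"
      using lrwhisk[OF n(1) K(1) u] by (simp add: n)
    also have "\<dots> = (U \<rhd> (q \<lhd> K)) \<bullet> (\<eta> \<lhd> U)"
      unfolding \<sigma>_def rwhisk_VComp[OF \<eta>u Uq K(1)]
      using lrwhisk[OF q K(1) U] rwhisk_Comp[OF \<eta> u K(1)] by (simp add: K)
    also have "(U \<rhd> c) \<bullet> \<dots> = ((U \<rhd> c) \<bullet> (U \<rhd> (q \<lhd> K))) \<bullet> (\<eta> \<lhd> U)"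
      by (rule VComp_assoc[OF \<eta>U UqK Uc, symmetric])
    also have "(U \<rhd> c) \<bullet> (U \<rhd> (q \<lhd> K)) = U \<rhd> \<epsilon>"
      using lwhisk_VComp[OF qK c(1) U] by (simp add: c)
    finally show "u \<rhd> ((K \<rhd> c) \<bullet> (n \<lhd> K)) = u \<rhd> Id2 A K"
      by (simp add: tri_U lwhisk_Id2[OF K(1) u] K)
  qed
  have cs: "c \<lhd> s \<in> Hom2 A E M (s \<odot> (K \<odot> s)) s"
    using rwhisk_in[OF s c(1)] by (simp add: Comp1_assoc[OF s K(1) s] Comp1_Id_left[OF s])
  have sn: "s \<rhd> n \<in> Hom2 A E M s (s \<odot> (K \<odot> s))"
    using lwhisk_in[OF n(1) s] by (simp add: Comp1_Id_right[OF s])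
  have tri1: "(c \<lhd> s) \<bullet> (s \<rhd> n) = Id2 A s"
  proof (rule q_whisk_epi[OF Id1_in[OF Obj(3)], of _ s])
    have qKs: "q \<lhd> (K \<odot> s) \<in> Hom2 A E M (r \<odot> (U \<odot> s)) (s \<odot> (K \<odot> s))"
      by (rule q_whisk_in[OF Ks uKs])
    have r\<sigma>: "r \<rhd> \<sigma> \<in> Hom2 A E M (r \<odot> u) (r \<odot> (U \<odot> s))" by (rule lwhisk_in[OF \<sigma> r])
    have "((c \<lhd> s) \<bullet> (s \<rhd> n)) \<bullet> q = (c \<lhd> s) \<bullet> ((s \<rhd> n) \<bullet> q)"
      by (rule VComp_assoc[OF q sn cs])
    also have "(s \<rhd> n) \<bullet> q = (q \<lhd> (K \<odot> s)) \<bullet> (r \<rhd> \<sigma>)"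
      using whisker_swap[OF n(1) q] by (simp add: rwhisk_Id1[OF q] lwhisk_Comp[OF n(1) u r] n)
    also have "(c \<lhd> s) \<bullet> \<dots> = ((c \<lhd> s) \<bullet> (q \<lhd> (K \<odot> s))) \<bullet> (r \<rhd> \<sigma>)"
      by (rule VComp_assoc[OF r\<sigma> qKs cs, symmetric])
    also have "(c \<lhd> s) \<bullet> (q \<lhd> (K \<odot> s)) = \<epsilon> \<lhd> s"
      using rwhisk_VComp[OF qK c(1) s] by (simp add: c rwhisk_Comp[OF q K(1) s])
    finally show "((c \<lhd> s) \<bullet> (s \<rhd> n)) \<bullet> (q \<lhd> Id1 A E) = Id2 A s \<bullet> (q \<lhd> Id1 A E)"
      by (simp add: tr rwhisk_Id1[OF q] VComp_Id_left[OF q])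
  qed (simp_all add: Comp1_Id_right[OF s] VComp_in[OF sn cs] Id2_in[OF s])
  show ?thesis using s K(1) n(1) c(1) tri1 tri2 unfolding adjunction_def by blast
qed

end



section \<open>Cells of the lax slice\<close>

lemma lax_slice_simps [simp]:
  "(X, x) \<in> Obj (lax_slice A M) \<longleftrightarrow> X \<in> Obj A \<and> x \<in> Hom1 A X M"
  "(F, \<theta>) \<in> Hom1 (lax_slice A M) (X, x) (Y, y) \<longleftrightarrow> x \<in> Hom1 A X M \<and> y \<in> Hom1 A Y M \<and>
    F \<in> Hom1 A X Y \<and> \<theta> \<in> Hom2 A X M (Comp1 A y F) x"
  "\<tau> \<in> Hom2 (lax_slice A M) (X, x) (Y, y) (F, \<theta>) (F', \<theta>') \<longleftrightarrow> \<tau> \<in> Hom2 A X Y F F' \<and>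
    x \<in> Hom1 A X M \<and> y \<in> Hom1 A Y M \<and> \<theta> \<in> Hom2 A X M (Comp1 A y F) x \<and>
    \<theta>' \<in> Hom2 A X M (Comp1 A y F') x \<and> VComp A \<theta>' (lwhisk A y \<tau>) = \<theta>"
  "Id1 (lax_slice A M) (X, x) = (Id1 A X, Id2 A x)"
  "Comp1 (lax_slice A M) (G, \<gamma>) (F, \<theta>) = (Comp1 A G F, VComp A \<theta> (rwhisk A \<gamma> F))"
  "Id2 (lax_slice A M) (F, \<theta>) = Id2 A F"
  "VComp (lax_slice A M) = VComp A"
  "HComp (lax_slice A M) = HComp A"
  "lwhisk (lax_slice A M) (F, \<theta>) \<tau> = lwhisk A F \<tau>"
  "rwhisk (lax_slice A M) \<tau> (F, \<theta>) = rwhisk A \<tau> F"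
  by (auto simp: lax_slice_def lwhisk_def rwhisk_def)

lemma lax_slice_Hom1D:
  assumes "k \<in> Hom1 (lax_slice A M) X Y"
  shows "fst k \<in> Hom1 A (fst X) (fst Y)"
  using assms by (cases k; cases X; cases Y) simp

lemma lax_slice_fst_simps:
  "fst (Comp1 (lax_slice A M) g f) = Comp1 A (fst g) (fst f)"
  "fst (Id1 (lax_slice A M) X) = Id1 A (fst X)"
  "lwhisk (lax_slice A M) g \<tau> = lwhisk A (fst g) \<tau>"
  "rwhisk (lax_slice A M) \<tau> g = rwhisk A \<tau> (fst g)"
  "Id2 (lax_slice A M) g = Id2 A (fst g)"
  by (simp_all add: lax_slice_def lwhisk_def rwhisk_def split_beta)

lemma lax_slice_Hom2D:
  assumes "\<tau> \<in> Hom2 (lax_slice A M) X Y f g"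
  shows "\<tau> \<in> Hom2 A (fst X) (fst Y) (fst f) (fst g)"
  using assms by (cases f; cases g; cases X; cases Y) simp

lemma lax_slice_adjunctionD:
  assumes "adjunction (lax_slice A M) X Y l u \<eta> \<epsilon>"
  shows "adjunction A (fst X) (fst Y) (fst l) (fst u) \<eta> \<epsilon>"
  using assms lax_slice_Hom1D[of l A M X Y] lax_slice_Hom1D[of u A M Y X]
    lax_slice_Hom2D[of \<eta> A M X X "Id1 (lax_slice A M) X"] lax_slice_Hom2D[of \<epsilon> A M Y Y]
  by (fastforce simp: adjunction_def lax_slice_fst_simps)

lemma lax_slice_comparisonD:
  assumes "comparison (lax_slice A M) E u \<beta> X v \<epsilon> k"
  shows "comparison A (fst E) (fst u) \<beta> (fst X) (fst v) \<epsilon> (fst k)"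
  using assms lax_slice_Hom1D[of k A M X E] by (auto simp: comparison_def lax_slice_fst_simps)

text \<open>
  The domain 2-functor preserves the equational part of a kem-diagram, so only the monad and the two
  universal properties have to be supplied downstairs.
\<close>

lemma kem_diagram_projection:
  assumes L: "kem_diagram (lax_slice A M) L"
    and mon: "is_monad A (monad_of (map_kem fst fst (\<lambda>\<tau>. \<tau>) L))"
    and kl: "kleisli_object A (monad_of (map_kem fst fst (\<lambda>\<tau>. \<tau>) L)) (fst (Kl L)) (fst (KlF L)) (Kappa L)"
    and em: "em_object A (monad_of (map_kem fst fst (\<lambda>\<tau>. \<tau>) L)) (fst (EM L)) (fst (EMU L)) (Beta L)"
  shows "kem_diagram A (map_kem fst fst (\<lambda>\<tau>. \<tau>) L)"
proof -
  let ?S = "lax_slice A M"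
  have K: "adjunction ?S (Base L) (Kl L) (KlF L) (KlU L) (MUnit L) (KlCounit L)"
    and E: "adjunction ?S (Base L) (EM L) (EMF L) (EMU L) (MUnit L) (EMCounit L)"
    and J: "comparison ?S (EM L) (EMU L) (Beta L) (Kl L) (KlU L) (KlCounit L) (Cmp L)"
    and eq: "Comp1 ?S (KlU L) (KlF L) = Endo L" "lwhisk ?S (KlU L) (Kappa L) = Mult L"
      "rwhisk ?S (KlCounit L) (KlF L) = Kappa L"
      "Comp1 ?S (EMU L) (EMF L) = Endo L" "rwhisk ?S (Beta L) (EMF L) = Mult L"
      "lwhisk ?S (EMU L) (EMCounit L) = Beta L"
    using L by (auto simp: kem_diagram_def)
  show ?thesis
    using mon kl em lax_slice_adjunctionD[OF K] lax_slice_adjunctionD[OF E] lax_slice_comparisonD[OF J]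
      eq eq(1,4)[THEN arg_cong, of fst, unfolded lax_slice_fst_simps]
    by (simp add: kem_diagram_def map_kem_def lax_slice_fst_simps)
qed

lemma bij_betw_Collect_iff:
  assumes "bij_betw g X Y" "\<And>x. x \<in> X \<Longrightarrow> P x \<longleftrightarrow> Q (g x)"
  shows "bij_betw g {x \<in> X. P x} {y \<in> Y. Q y}"
  using assms by (auto simp: bij_betw_def inj_on_def)


section \<open>Lifting to the lax slice\<close>

text \<open>
  The Kleisli object \<open>(L, f, \<kappa>)\<close> is added, with the 1-cell \<open>t : L \<rightarrow> M\<close> induced by \<open>(r, \<epsilon>\<^sub>r)\<close>.
\<close>

locale kem_lifting = em_coequalizer +
  fixes L f \<kappa> t
  assumes kl: "kleisli_object A N L f \<kappa>"
    and t: "t \<in> Hom1 A L M" "t \<odot> f = r" "t \<rhd> \<kappa> = \<epsilon> \<lhd> r"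
begin

abbreviation S where "S \<equiv> lax_slice A M"
abbreviation N' where "N' \<equiv> \<lparr>Base = (C, r), Endo = (R, \<epsilon> \<lhd> r), MUnit = \<eta>, Mult = \<mu>\<rparr>"

sublocale slice: two_category S by (rule lax_slice_two_category)
sublocale op: two_category "op1 A" by (rule op1_two_category)

lemma op_em: "em_object (op1 A) N L f \<kappa>"
  using kl by (simp add: op1_em_object)

lemma f: "f \<in> Hom1 A C L" and \<kappa>: "\<kappa> \<in> Hom2 A C L (f \<odot> R) f"
  using op.em_object_in[OF op_em] by auto

lemma lifted_adjunction: "adjunction S (C, r) (M, Id1 A M) (r, Id2 A r) (U, \<epsilon>) \<eta> \<epsilon>"
  using adj r U \<eta> \<epsilon> \<epsilon>r Obj
  by (auto simp: adjunction_def Id1_in Id2_in Comp1_Id_left VComp_Id_left VComp_Id_right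
      rwhisk_Id2 tri_r tri_U lwhisk_Id1 Comp1_in Comp1_assoc[OF r U r]
      Comp1_Id_right[OF r] Comp1_Id_left[OF Comp1_in[OF U r]] Comp1_Id_left[OF Id1_in[OF Obj(2)]])

text \<open>
  It is the monad of the lifted adjunction; no law has to be checked again.
\<close>

lemma lifted_monad: "is_monad S N'"
  using slice.adjunction_is_monad[OF lifted_adjunction] by (simp add: VComp_Id_left[OF \<epsilon>r])

text \<open>
  The equation is the condition for \<open>\<nu>\<close> to be a 2-cell of the slice. It is exactly the hypothesis
  of \<open>q_descent\<close>.
\<close>

lemma lifted_Subeq_iff:
  "((v, \<theta>), \<nu>) \<in> Subeq S N' (X, x) \<longleftrightarrow> (v, \<nu>) \<in> Subeq A N X \<and> x \<in> Hom1 A X M \<and>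
    \<theta> \<in> Hom2 A X M (r \<odot> v) x \<and> \<theta> \<bullet> (r \<rhd> \<nu>) = \<theta> \<bullet> ((\<epsilon> \<lhd> r) \<lhd> v)"
proof -
  have "\<theta> \<bullet> ((\<epsilon> \<lhd> r) \<lhd> v) \<in> Hom2 A X M (r \<odot> (R \<odot> v)) x"
    if "v \<in> Hom1 A X C" "\<theta> \<in> Hom2 A X M (r \<odot> v) x"
    using VComp_in[OF rwhisk_in[OF that(1) \<epsilon>r] that(2)] by (simp add: Comp1_assoc[OF that(1) R r])
  then show ?thesis using r by (auto simp: Subeq_def)
qed

text \<open>
  Here the condition for \<open>\<nu>\<close> to be a 2-cell of the slice makes \<open>\<theta>\<close> a morphism of subcoequalizings
  from \<open>(x v, x(\<nu>))\<close> to \<open>(r, \<epsilon>\<^sub>r)\<close>.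
\<close>

lemma lifted_Subcoeq_iff:
  "((v, \<theta>), \<nu>) \<in> Subcoeq S N' (X, x) \<longleftrightarrow> (v, \<nu>) \<in> Subcoeq A N X \<and> x \<in> Hom1 A X M \<and>
    \<theta> \<in> Hom2 A C M (x \<odot> v) r \<and> \<theta> \<bullet> (x \<rhd> \<nu>) = (\<epsilon> \<lhd> r) \<bullet> (\<theta> \<lhd> R)"
proof -
  have "(\<epsilon> \<lhd> r) \<bullet> (\<theta> \<lhd> R) \<in> Hom2 A C M (x \<odot> (v \<odot> R)) r"
    if "v \<in> Hom1 A C X" "x \<in> Hom1 A X M" "\<theta> \<in> Hom2 A C M (x \<odot> v) r"
    using VComp_in[OF rwhisk_in[OF R that(3)] \<epsilon>r] by (simp add: Comp1_assoc[OF R that(1,2)])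
  then show ?thesis using r by (auto simp: Subcoeq_def)
qed

text \<open>
  Compared with the universal property of \<open>E\<close> in \<open>\<A>\<close>, a lifted 1-cell carries in addition a 2-cell
  out of \<open>s k\<close> and a lifted subequalizing one out of \<open>r u k\<close>, and these correspond under \<open>q\<^sub>k\<close>. On
  2-cells the bijection of \<open>\<A>\<close> is restricted to those compatible with the legs; the two
  compatibilities agree because \<open>q\<^sub>k\<close> is epimorphic.
\<close>

lemma lifted_em_object: "em_object S N' (E, s) (u, q) \<beta>"
proof -
  have obj: "bij_betw (\<lambda>k. ((u, q) \<odot>\<^bsub>S\<^esub> k, \<beta> \<lhd>\<^bsub>S\<^esub> k)) (Hom1 S (X, x) (E, s)) (Subeq S N' (X, x))"
    if X: "X \<in> Obj A" and x: "x \<in> Hom1 A X M" for X x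
  proof (rule bij_betwI')
    fix k l assume kl: "k \<in> Hom1 S (X, x) (E, s)" "l \<in> Hom1 S (X, x) (E, s)"
    obtain k1 k2 l1 l2 where [simp]: "k = (k1, k2)" "l = (l1, l2)" by (cases k; cases l)
    have k: "k1 \<in> Hom1 A X E" "k2 \<in> Hom2 A X M (s \<odot> k1) x"
      and l: "l1 \<in> Hom1 A X E" "l2 \<in> Hom2 A X M (s \<odot> l1) x" using kl by auto
    show "((u, q) \<odot>\<^bsub>S\<^esub> k, \<beta> \<lhd>\<^bsub>S\<^esub> k) = ((u, q) \<odot>\<^bsub>S\<^esub> l, \<beta> \<lhd>\<^bsub>S\<^esub> l) \<longleftrightarrow> k = l"
    proof
      assume a: "((u, q) \<odot>\<^bsub>S\<^esub> k, \<beta> \<lhd>\<^bsub>S\<^esub> k) = ((u, q) \<odot>\<^bsub>S\<^esub> l, \<beta> \<lhd>\<^bsub>S\<^esub> l)"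
      then have "k1 = l1" using em_object_1cell_eqI[OF em k(1) l(1)] by simp
      moreover from this have "k2 = l2" using a q_whisk_epi[OF k] l by simp
      ultimately show "k = l" by simp
    qed simp
  next
    fix k assume k0: "k \<in> Hom1 S (X, x) (E, s)"
    obtain k1 k2 where [simp]: "k = (k1, k2)" by (cases k)
    have k: "k1 \<in> Hom1 A X E" "k2 \<in> Hom2 A X M (s \<odot> k1) x" using k0 by auto
    note qk = q_whisk_in[OF k(1) refl]
    note a = lwhisk_in[OF rwhisk_in[OF k(1) \<beta>] r]
    note uk = Comp1_in[OF k(1) u]
    have b: "(\<epsilon> \<lhd> r) \<lhd> (u \<odot> k1) \<in> Hom2 A X M (r \<odot> ((R \<odot> u) \<odot> k1)) (r \<odot> (u \<odot> k1))"
      using rwhisk_in[OF uk \<epsilon>r] by (simp add: Comp1_assoc[OF uk R r] Comp1_assoc[OF k(1) u R])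
    have "(u \<odot> k1, \<beta> \<lhd> k1) \<in> Subeq A N X"
      using em X k(1) by (auto simp: em_object_def dest!: bij_betw_imp_surj_on)
    then show "((u, q) \<odot>\<^bsub>S\<^esub> k, \<beta> \<lhd>\<^bsub>S\<^esub> k) \<in> Subeq S N' (X, x)"
      using x VComp_in[OF qk k(2)] q_whisk_coeq[OF k(1) refl refl]
      by (simp add: lifted_Subeq_iff VComp_assoc[OF a qk k(2)] VComp_assoc[OF b qk k(2)])
  next
    fix y assume y: "y \<in> Subeq S N' (X, x)"
    obtain v \<theta> \<nu> where [simp]: "y = ((v, \<theta>), \<nu>)" by (cases y) auto
    have v: "(v, \<nu>) \<in> Subeq A N X" and \<theta>: "\<theta> \<in> Hom2 A X M (r \<odot> v) x"
      "\<theta> \<bullet> (r \<rhd> \<nu>) = \<theta> \<bullet> ((\<epsilon> \<lhd> r) \<lhd> v)" using y by (auto simp: lifted_Subeq_iff)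
    obtain k where k: "k \<in> Hom1 A X E" "u \<odot> k = v" "\<beta> \<lhd> k = \<nu>"
      using em_object_1cell_ex1[OF em v] by blast
    obtain \<theta>' where \<theta>': "\<theta>' \<in> Hom2 A X M (s \<odot> k) x" "\<theta>' \<bullet> (q \<lhd> k) = \<theta>"
      using q_descent[OF k \<theta>] by blast
    show "\<exists>k\<in>Hom1 S (X, x) (E, s). y = ((u, q) \<odot>\<^bsub>S\<^esub> k, \<beta> \<lhd>\<^bsub>S\<^esub> k)"
      by (rule bexI[of _ "(k, \<theta>')"]) (use k \<theta>' x s in simp_all)
  qed
  have mor: "bij_betw (\<lambda>\<tau>. (u, q) \<rhd>\<^bsub>S\<^esub> \<tau>) (Hom2 S (X, x) (E, s) k l)
      (Subeq_mor S N' (X, x) ((u, q) \<odot>\<^bsub>S\<^esub> k, \<beta> \<lhd>\<^bsub>S\<^esub> k) ((u, q) \<odot>\<^bsub>S\<^esub> l, \<beta> \<lhd>\<^bsub>S\<^esub> l))"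
    if kl: "k \<in> Hom1 S (X, x) (E, s)" "l \<in> Hom1 S (X, x) (E, s)" for X x k l
  proof -
    obtain k1 k2 l1 l2 where [simp]: "k = (k1, k2)" "l = (l1, l2)" by (cases k; cases l)
    have k: "k1 \<in> Hom1 A X E" "k2 \<in> Hom2 A X M (s \<odot> k1) x" and x: "x \<in> Hom1 A X M"
      and l: "l1 \<in> Hom1 A X E" "l2 \<in> Hom2 A X M (s \<odot> l1) x" using kl by auto
    have X: "X \<in> Obj A" using x Hom1_Obj by blast
    note qk = q_whisk_in[OF k(1) refl] and ql = q_whisk_in[OF l(1) refl]
    have "bij_betw (\<lambda>\<tau>. u \<rhd> \<tau>) {\<tau> \<in> Hom2 A X E k1 l1. l2 \<bullet> (s \<rhd> \<tau>) = k2}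
        {\<sigma> \<in> Subeq_mor A N X (u \<odot> k1, \<beta> \<lhd> k1) (u \<odot> l1, \<beta> \<lhd> l1).
          (l2 \<bullet> (q \<lhd> l1)) \<bullet> (r \<rhd> \<sigma>) = k2 \<bullet> (q \<lhd> k1)}"
    proof (rule bij_betw_Collect_iff)
      show "bij_betw (\<lambda>\<tau>. u \<rhd> \<tau>) (Hom2 A X E k1 l1)
          (Subeq_mor A N X (u \<odot> k1, \<beta> \<lhd> k1) (u \<odot> l1, \<beta> \<lhd> l1))"
        using em X k(1) l(1) by (auto simp: em_object_def)
      fix \<tau> assume \<tau>: "\<tau> \<in> Hom2 A X E k1 l1"
      note s\<tau> = lwhisk_in[OF \<tau> s]
      have ru\<tau>: "r \<rhd> (u \<rhd> \<tau>) \<in> Hom2 A X M (r \<odot> (u \<odot> k1)) (r \<odot> (u \<odot> l1))"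
        by (rule lwhisk_in[OF lwhisk_in[OF \<tau> u] r])
      have "(l2 \<bullet> (q \<lhd> l1)) \<bullet> (r \<rhd> (u \<rhd> \<tau>)) = l2 \<bullet> ((q \<lhd> l1) \<bullet> (r \<rhd> (u \<rhd> \<tau>)))"
        by (rule VComp_assoc[OF ru\<tau> ql l(2)])
      also have "(q \<lhd> l1) \<bullet> (r \<rhd> (u \<rhd> \<tau>)) = (s \<rhd> \<tau>) \<bullet> (q \<lhd> k1)"
        using whisker_swap[OF \<tau> q] by (simp add: lwhisk_Comp[OF \<tau> u r])
      also have "l2 \<bullet> \<dots> = (l2 \<bullet> (s \<rhd> \<tau>)) \<bullet> (q \<lhd> k1)"
        by (rule VComp_assoc[OF qk s\<tau> l(2), symmetric])
      finally show "l2 \<bullet> (s \<rhd> \<tau>) = k2 \<longleftrightarrow> (l2 \<bullet> (q \<lhd> l1)) \<bullet> (r \<rhd> (u \<rhd> \<tau>)) = k2 \<bullet> (q \<lhd> k1)"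
        using q_whisk_epi[OF k(1) VComp_in[OF s\<tau> l(2)] k(2)] by auto
    qed
    moreover have "Hom2 S (X, x) (E, s) k l = {\<tau> \<in> Hom2 A X E k1 l1. l2 \<bullet> (s \<rhd> \<tau>) = k2}"
      using k l x s by auto
    moreover have "Subeq_mor S N' (X, x) ((u, q) \<odot>\<^bsub>S\<^esub> k, \<beta> \<lhd>\<^bsub>S\<^esub> k) ((u, q) \<odot>\<^bsub>S\<^esub> l, \<beta> \<lhd>\<^bsub>S\<^esub> l) =
        {\<sigma> \<in> Subeq_mor A N X (u \<odot> k1, \<beta> \<lhd> k1) (u \<odot> l1, \<beta> \<lhd> l1).
          (l2 \<bullet> (q \<lhd> l1)) \<bullet> (r \<rhd> \<sigma>) = k2 \<bullet> (q \<lhd> k1)}"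
      using VComp_in[OF qk k(2)] VComp_in[OF ql l(2)] x r by (auto simp: Subeq_mor_def)
    ultimately show ?thesis by simp
  qed
  have "((u, q), \<beta>) \<in> Subeq S N' (E, s)"
    using em q s q_coeq by (simp add: lifted_Subeq_iff em_object_def)
  then show ?thesis using Obj s obj mor by (auto simp: em_object_def)
qed

text \<open>
  The legs into \<open>t\<close> and the legs into \<open>r = t f\<close> correspond by the bijection on 2-cells of the Kleisli
  object in \<open>\<A>\<close>, used with codomain \<open>M\<close>. Faithfulness of whiskering with \<open>f\<close> gives the statement
  on 2-cells.
\<close>

lemma lifted_kleisli_object: "kleisli_object S N' (L, t) (f, Id2 A r) \<kappa>"
proof -
  have L: "L \<in> Obj A" using f Hom1_Obj by blast
  have f_in: "\<theta> \<lhd> f \<in> Hom2 A C M (x \<odot> (k \<odot> f)) r"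
    if "k \<in> Hom1 A L X" "x \<in> Hom1 A X M" "\<theta> \<in> Hom2 A L M (x \<odot> k) t" for k x \<theta> X
    using rwhisk_in[OF f that(3)] by (simp add: t(2) Comp1_assoc[OF f that(1,2)])
  have comp: "k \<odot>\<^bsub>S\<^esub> (f, Id2 A r) = (fst k \<odot> f, snd k \<lhd> f)"
    if "k \<in> Hom1 S (L, t) (X, x)" for k X x
    using that f_in by (cases k) (auto intro!: VComp_Id_left)
  have obj: "bij_betw (\<lambda>k. (k \<odot>\<^bsub>S\<^esub> (f, Id2 A r), k \<rhd>\<^bsub>S\<^esub> \<kappa>)) (Hom1 S (L, t) (X, x)) (Subcoeq S N' (X, x))"
    if X: "X \<in> Obj A" and x: "x \<in> Hom1 A X M" for X x
  proof (rule bij_betwI')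
    fix k l assume kl: "k \<in> Hom1 S (L, t) (X, x)" "l \<in> Hom1 S (L, t) (X, x)"
    obtain k1 k2 l1 l2 where [simp]: "k = (k1, k2)" "l = (l1, l2)" by (cases k; cases l)
    have k: "k1 \<in> Hom1 A L X" "k2 \<in> Hom2 A L M (x \<odot> k1) t"
      and l: "l1 \<in> Hom1 A L X" "l2 \<in> Hom2 A L M (x \<odot> l1) t" using kl by auto
    show "(k \<odot>\<^bsub>S\<^esub> (f, Id2 A r), k \<rhd>\<^bsub>S\<^esub> \<kappa>) = (l \<odot>\<^bsub>S\<^esub> (f, Id2 A r), l \<rhd>\<^bsub>S\<^esub> \<kappa>) \<longleftrightarrow> k = l"
    proof
      assume a: "(k \<odot>\<^bsub>S\<^esub> (f, Id2 A r), k \<rhd>\<^bsub>S\<^esub> \<kappa>) = (l \<odot>\<^bsub>S\<^esub> (f, Id2 A r), l \<rhd>\<^bsub>S\<^esub> \<kappa>)"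
      then have b: "k1 \<odot> f = l1 \<odot> f" "k2 \<lhd> f = l2 \<lhd> f" "k1 \<rhd> \<kappa> = l1 \<rhd> \<kappa>"
        using comp[OF kl(1)] comp[OF kl(2)] by simp_all
      then have "k1 = l1" using op.em_object_1cell_eqI[OF op_em, of k1 X l1] k l by simp
      moreover from this have "k2 = l2"
        using op.em_object_2cell_eqI[OF op_em, of k2 M "x \<odot> k1" t l2] k l b by simp
      ultimately show "k = l" by simp
    qed simp
  next
    fix k assume k0: "k \<in> Hom1 S (L, t) (X, x)"
    obtain k1 k2 where [simp]: "k = (k1, k2)" by (cases k)
    have k: "k1 \<in> Hom1 A L X" "k2 \<in> Hom2 A L M (x \<odot> k1) t" using k0 by auto
    have "(k1 \<odot> f, k1 \<rhd> \<kappa>) \<in> Subcoeq A N X"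
      using kl X k(1) by (auto simp: kleisli_object_def dest!: bij_betw_imp_surj_on)
    moreover have "(k2 \<lhd> f) \<bullet> (x \<rhd> (k1 \<rhd> \<kappa>)) = (\<epsilon> \<lhd> r) \<bullet> ((k2 \<lhd> f) \<lhd> R)"
      using whisker_swap[OF \<kappa> k(2)]
      by (simp add: t(3) lwhisk_Comp[OF \<kappa> k(1) x] rwhisk_Comp[OF k(2) f R])
    ultimately show "(k \<odot>\<^bsub>S\<^esub> (f, Id2 A r), k \<rhd>\<^bsub>S\<^esub> \<kappa>) \<in> Subcoeq S N' (X, x)"
      unfolding comp[OF k0] using x f_in[OF k(1) x k(2)] by (simp add: lifted_Subcoeq_iff)
  next
    fix y assume y: "y \<in> Subcoeq S N' (X, x)"
    obtain v \<theta> \<nu> where [simp]: "y = ((v, \<theta>), \<nu>)" by (cases y) auto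
    have v: "(v, \<nu>) \<in> Subcoeq A N X" and \<theta>: "\<theta> \<in> Hom2 A C M (x \<odot> v) r"
      "\<theta> \<bullet> (x \<rhd> \<nu>) = (\<epsilon> \<lhd> r) \<bullet> (\<theta> \<lhd> R)" using y by (auto simp: lifted_Subcoeq_iff)
    obtain k where k: "k \<in> Hom1 A L X" "k \<odot> f = v" "k \<rhd> \<kappa> = \<nu>"
      using op.em_object_1cell_ex1[OF op_em, of v \<nu> X] v by (auto simp: op1_Subeq)
    note xk = Comp1_in[OF k(1) x]
    have xkf: "(x \<odot> k) \<odot> f = x \<odot> v" "(x \<odot> k) \<rhd> \<kappa> = x \<rhd> \<nu>"
      using Comp1_assoc[OF f k(1) x] lwhisk_Comp[OF \<kappa> k(1) x] by (simp_all add: k)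
    obtain \<theta>' where \<theta>': "\<theta>' \<in> Hom2 A L M (x \<odot> k) t" "\<theta>' \<lhd> f = \<theta>"
      using op.em_object_2cell_ex1[OF op_em, of "x \<odot> k" M t \<theta>] xk t \<theta> xkf by auto
    have k0: "(k, \<theta>') \<in> Hom1 S (L, t) (X, x)" using k \<theta>' x t by simp
    show "\<exists>k\<in>Hom1 S (L, t) (X, x). y = (k \<odot>\<^bsub>S\<^esub> (f, Id2 A r), k \<rhd>\<^bsub>S\<^esub> \<kappa>)"
      by (rule bexI[OF _ k0], unfold comp[OF k0]) (use k \<theta>' in simp)
  qed
  have mor: "bij_betw (\<lambda>\<tau>. \<tau> \<lhd>\<^bsub>S\<^esub> (f, Id2 A r)) (Hom2 S (L, t) (X, x) k l)
      (Subcoeq_mor S N' (X, x) (k \<odot>\<^bsub>S\<^esub> (f, Id2 A r), k \<rhd>\<^bsub>S\<^esub> \<kappa>) (l \<odot>\<^bsub>S\<^esub> (f, Id2 A r), l \<rhd>\<^bsub>S\<^esub> \<kappa>))"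
    if kl': "k \<in> Hom1 S (L, t) (X, x)" "l \<in> Hom1 S (L, t) (X, x)" for X x k l
  proof -
    obtain k1 k2 l1 l2 where [simp]: "k = (k1, k2)" "l = (l1, l2)" by (cases k; cases l)
    have k: "k1 \<in> Hom1 A L X" "k2 \<in> Hom2 A L M (x \<odot> k1) t" and x: "x \<in> Hom1 A X M"
      and l: "l1 \<in> Hom1 A L X" "l2 \<in> Hom2 A L M (x \<odot> l1) t" using kl' by auto
    have X: "X \<in> Obj A" using x Hom1_Obj by blast
    have "bij_betw (\<lambda>\<tau>. \<tau> \<lhd> f) {\<tau> \<in> Hom2 A L X k1 l1. l2 \<bullet> (x \<rhd> \<tau>) = k2}
        {\<sigma> \<in> Subcoeq_mor A N X (k1 \<odot> f, k1 \<rhd> \<kappa>) (l1 \<odot> f, l1 \<rhd> \<kappa>).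
          (l2 \<lhd> f) \<bullet> (x \<rhd> \<sigma>) = k2 \<lhd> f}"
    proof (rule bij_betw_Collect_iff)
      show "bij_betw (\<lambda>\<tau>. \<tau> \<lhd> f) (Hom2 A L X k1 l1)
          (Subcoeq_mor A N X (k1 \<odot> f, k1 \<rhd> \<kappa>) (l1 \<odot> f, l1 \<rhd> \<kappa>))"
        using kl X k(1) l(1) by (auto simp: kleisli_object_def)
      fix \<tau> assume \<tau>: "\<tau> \<in> Hom2 A L X k1 l1"
      note x\<tau> = lwhisk_in[OF \<tau> x]
      have "(l2 \<lhd> f) \<bullet> (x \<rhd> (\<tau> \<lhd> f)) = (l2 \<bullet> (x \<rhd> \<tau>)) \<lhd> f"
        using rwhisk_VComp[OF x\<tau> l(2) f] lrwhisk[OF \<tau> f x] by simp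
      then show "l2 \<bullet> (x \<rhd> \<tau>) = k2 \<longleftrightarrow> (l2 \<lhd> f) \<bullet> (x \<rhd> (\<tau> \<lhd> f)) = k2 \<lhd> f"
        using op.em_object_2cell_eqI[OF op_em, of "l2 \<bullet> (x \<rhd> \<tau>)" M "x \<odot> k1" t k2]
          VComp_in[OF x\<tau> l(2)] k(2) by auto
    qed
    moreover have "Hom2 S (L, t) (X, x) k l = {\<tau> \<in> Hom2 A L X k1 l1. l2 \<bullet> (x \<rhd> \<tau>) = k2}"
      using k l x t by auto
    moreover have "Subcoeq_mor S N' (X, x) (k \<odot>\<^bsub>S\<^esub> (f, Id2 A r), k \<rhd>\<^bsub>S\<^esub> \<kappa>)
        (l \<odot>\<^bsub>S\<^esub> (f, Id2 A r), l \<rhd>\<^bsub>S\<^esub> \<kappa>) =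
        {\<sigma> \<in> Subcoeq_mor A N X (k1 \<odot> f, k1 \<rhd> \<kappa>) (l1 \<odot> f, l1 \<rhd> \<kappa>).
          (l2 \<lhd> f) \<bullet> (x \<rhd> \<sigma>) = k2 \<lhd> f}"
      unfolding comp[OF kl'(1)] comp[OF kl'(2)]
      using f_in[OF k(1) x k(2)] f_in[OF l(1) x l(2)] x r by (auto simp: Subcoeq_mor_def)
    ultimately show ?thesis by simp
  qed
  have "((f, Id2 A r), \<kappa>) \<in> Subcoeq S N' (L, t)"
    using kl t Id2_in[OF r] VComp_Id_left[OF \<epsilon>r] VComp_Id_right[OF \<epsilon>r]
    by (simp add: lifted_Subcoeq_iff kleisli_object_def rwhisk_Id2[OF R r])
  then show ?thesis using L t obj mor by (auto simp: kleisli_object_def)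
qed

text \<open>
  The slice has a unique kem-diagram on the lifted monad, Kleisli object and Eilenberg--Moore object.
  Its image in \<open>\<A>\<close> is a kem-diagram on the given data, hence is \<open>D\<close>. It remains to recognize the
  legs: that of the right adjoint \<open>KlU D\<close> is determined by its whiskering with \<open>f\<close>, that of \<open>F\<close> by its
  composite with \<open>q\<^sub>F\<close>. The leg \<open>w\<close> of the comparison is part of the unique diagram.
\<close>

lemma lifted_kem_diagram:
  assumes D: "kem_diagram A D" "monad_of D = N" "(Kl D, KlF D, Kappa D) = (L, f, \<kappa>)"
      "(EM D, EMU D, Beta D) = (E, u, \<beta>)"
    and v: "v \<in> Hom2 A C M (s \<odot> F) r" "v \<bullet> (q \<lhd> F) = \<epsilon> \<lhd> r"
  shows "\<exists>!w. creates_kem S A fst fst (\<lambda>\<tau>. \<tau>) N' D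
    \<lparr>Base = (C, r), Endo = (R, \<epsilon> \<lhd> r), MUnit = \<eta>, Mult = \<mu>,
     Kl = (L, t), KlF = (f, Id2 A r), KlU = (KlU D, t \<rhd> KlCounit D),
     Kappa = \<kappa>, KlCounit = KlCounit D,
     EM = (E, s), EMF = (F, v), EMU = (u, q),
     Beta = \<beta>, EMCounit = e, Cmp = (Cmp D, w)\<rparr>" (is "\<exists>!w. creates_kem _ _ _ _ _ _ _ (?D w)")
proof -
  let ?p = "map_kem fst fst (\<lambda>\<tau>. \<tau>)"
  let ?kem = "\<lambda>D. kem_diagram S D \<and> monad_of D = N' \<and> (Kl D, KlF D, Kappa D) = ((L, t), (f, Id2 A r), \<kappa>) \<and>
      (EM D, EMU D, Beta D) = ((E, s), (u, q), \<beta>)"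
  have ex1: "\<exists>!D. ?kem D"
    by (rule slice.kem_diagram_ex1[OF lifted_monad lifted_kleisli_object lifted_em_object])
  then obtain D' where D': "?kem D'" by blast
  have pD': "monad_of (?p D') = N" using D' by (simp add: map_kem_def monad_data.defs)
  have kpD': "kem_diagram A (?p D')"
    by (rule kem_diagram_projection[of A M])
      (use D' monad kl em pD' in simp_all)
  have p: "?p D' = D"
    using kem_diagram_ex1[OF monad kl em] kpD' pD' D D' by (auto simp: map_kem_def)
  have Ee: "em_adjunction A N E (EMF D) u \<beta> (EMCounit D)"
    using D by (auto simp: kem_diagram_iff)
  have EF: "EMF D = F" "EMCounit D = e" using em_adjunction_unique[OF Ee em_adj] by auto
  have K': "adjunction S (C, r) (L, t) (f, Id2 A r) (KlU D') \<eta> (KlCounit D')"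
    "KlU D' \<odot>\<^bsub>S\<^esub> (f, Id2 A r) = (R, \<epsilon> \<lhd> r)"
    and E': "adjunction S (C, r) (E, s) (EMF D') (u, q) \<eta> (EMCounit D')"
    "(u, q) \<odot>\<^bsub>S\<^esub> EMF D' = (R, \<epsilon> \<lhd> r)"
    using D' by (auto simp: kem_diagram_def monad_data.defs)
  have KA: "adjunction A C L f (KlU D) \<eta> (KlCounit D)" "KlCounit D \<lhd> f = \<kappa>"
    using D by (auto simp: kem_diagram_def monad_data.defs)
  have fs: "fst (KlU D') = KlU D" "fst (EMF D') = F" "KlCounit D' = KlCounit D" "EMCounit D' = e"
    "fst (Cmp D') = Cmp D"
    using p EF by (auto simp: map_kem_def)
  obtain b where b: "KlU D' = (KlU D, b)" using fs by (cases "KlU D'") auto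
  obtain c where c: "EMF D' = (F, c)" using fs by (cases "EMF D'") auto
  have b1: "b \<in> Hom2 A L M (r \<odot> KlU D) t" using K'(1) by (simp add: adjunction_def b)
  have b2: "b \<lhd> f = \<epsilon> \<lhd> r"
  proof -
    have "b \<lhd> f \<in> Hom2 A C M ((r \<odot> KlU D) \<odot> f) r" using rwhisk_in[OF f b1] by (simp add: t)
    then show ?thesis using K'(2) VComp_Id_left by (simp add: b)
  qed
  have KU: "KlU D \<in> Hom1 A L C" "KlCounit D \<in> Hom2 A L L (f \<odot> KlU D) (Id1 A L)"
    using KA by (auto simp: adjunction_def)
  have b3: "t \<rhd> KlCounit D \<in> Hom2 A L M (r \<odot> KlU D) t"
    using lwhisk_in[OF KU(2) t(1)] by (simp add: Comp1_assoc[OF KU(1) f t(1), symmetric] t Comp1_Id_right[OF t(1)])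
  have "(t \<rhd> KlCounit D) \<lhd> f = \<epsilon> \<lhd> r"
    using lrwhisk[OF KU(2) f t(1)] by (simp add: KA t)
  then have bt: "b = t \<rhd> KlCounit D"
    using op.em_object_2cell_eqI[OF op_em, of b M "r \<odot> KlU D" t "t \<rhd> KlCounit D"] b1 b2 b3 by simp
  have "c \<in> Hom2 A C M (s \<odot> F) r" "c \<bullet> (q \<lhd> F) = \<epsilon> \<lhd> r"
    using E' by (auto simp: adjunction_def c)
  then have cv: "c = v" using v v_ex1 by blast
  have D'w: "D' = ?D (snd (Cmp D'))"
    by (rule kem_data.equality)
      (use D' b bt c cv fs in \<open>auto simp: monad_data.defs prod_eq_iff\<close>)
  show ?thesis
  proof (rule ex1I[of _ "snd (Cmp D')"])
    have "\<exists>!hg. kem_iso S D' L' (fst hg) (snd hg) \<and>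
        fst (fst hg) = Id1 A (Kl D) \<and> fst (snd hg) = Id1 A (EM D)"
      if L': "kem_diagram S L'" "monad_of L' = N'" "?p L' = D" for L'
    proof -
      have "\<exists>!hg. kem_iso S D' L' (fst hg) (snd hg)"
        by (rule slice.kem_iso_ex1) (use D' L' in simp_all)
      moreover have "fst (fst hg) = Id1 A (Kl D) \<and> fst (snd hg) = Id1 A (EM D)"
        if iso: "kem_iso S D' L' (fst hg) (snd hg)" for hg
      proof -
        obtain h g where [simp]: "hg = (h, g)" by (cases hg)
        have L'p: "fst (Kl L') = L" "fst (KlF L') = f" "Kappa L' = \<kappa>" "fst (EM L') = E"
            "fst (EMU L') = u" "Beta L' = \<beta>"
          using L'(3) D by (auto simp: map_kem_def)
        have D'p: "Kl D' = (L, t)" "KlF D' = (f, Id2 A r)" "Kappa D' = \<kappa>"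
            "EM D' = (E, s)" "EMU D' = (u, q)" "Beta D' = \<beta>" using D' by auto
        have h: "h \<in> Hom1 S (L, t) (Kl L')" "h \<odot>\<^bsub>S\<^esub> (f, Id2 A r) = KlF L'" "h \<rhd>\<^bsub>S\<^esub> \<kappa> = \<kappa>"
          and g: "g \<in> Hom1 S (E, s) (EM L')" "EMU L' \<odot>\<^bsub>S\<^esub> g = (u, q)" "\<beta> \<lhd>\<^bsub>S\<^esub> g = \<beta>"
          using iso by (auto simp: kem_iso_def iso_1cell_def D'p L'p)
        have h': "fst h \<in> Hom1 A L L" "fst h \<odot> f = f" "fst h \<rhd> \<kappa> = \<kappa>"
          using lax_slice_Hom1D[OF h(1)] arg_cong[OF h(2), of fst] h(3)
          by (simp_all add: lax_slice_fst_simps L'p)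
        have g': "fst g \<in> Hom1 A E E" "u \<odot> fst g = u" "\<beta> \<lhd> fst g = \<beta>"
          using lax_slice_Hom1D[OF g(1)] arg_cong[OF g(2), of fst] g(3)
          by (simp_all add: lax_slice_fst_simps L'p)
        have Lo: "L \<in> Obj A" using f Hom1_Obj by blast
        \<comment> \<open>Over \<open>\<A>\<close>, both components classify the universal cells themselves, hence are identities.\<close>
        have "fst h = Id1 A L"
          using op.em_object_1cell_eqI[OF op_em, of "fst h" L "Id1 A L"] h' Id1_in[OF Lo]
          by (simp add: Comp1_Id_left[OF f] lwhisk_Id1[OF \<kappa>])
        moreover have "fst g = Id1 A E"
          by (rule em_object_1cell_eqI[OF em g'(1) Id1_in[OF Obj(3)]])
            (simp_all add: g' Comp1_Id_right[OF u] rwhisk_Id1[OF \<beta>])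
        ultimately show ?thesis using D by simp
      qed
      ultimately show ?thesis by blast
    qed
    then show "creates_kem S A fst fst (\<lambda>\<tau>. \<tau>) N' D (?D (snd (Cmp D')))"
      unfolding D'w[symmetric] using D' p two_functor_dom by (simp add: creates_kem_def)
  next
    fix w assume "creates_kem S A fst fst (\<lambda>\<tau>. \<tau>) N' D (?D w)"
    then have "?kem (?D w)" by (simp add: creates_kem_def)
    then have "?D w = D'" using ex1 D' by blast
    then show "w = snd (Cmp D')" by auto
  qed
qed

end


section \<open>Creation of the kem-diagram\<close>

theorem theorem2p5:
  fixes A :: "('o, 'm, 'c) two_cat" (structure)
    and M C CK CE :: 'o
    and r U FK UE :: 'm
    and \<eta> \<epsilon> \<kappa> \<beta> :: 'c
    and N :: "('o, 'm, 'c) monad_data"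
  assumes "two_category A"
    and "rc_0cell A M"
    and "adjunction A C M r U \<eta> \<epsilon>"
    and "N = \<lparr>Base = C, Endo = U \<odot> r, MUnit = \<eta>, Mult = U \<rhd> (\<epsilon> \<lhd> r)\<rparr>"
    and "kleisli_object A N CK FK \<kappa>"
    and "em_object A N CE UE \<beta>"
  shows "(\<exists>!D. kem_diagram A D \<and> monad_of D = N \<and>
            (Kl D, KlF D, Kappa D) = (CK, FK, \<kappa>) \<and> (EM D, EMU D, Beta D) = (CE, UE, \<beta>)) \<and>
    (\<exists>!K. comparison A CE UE \<beta> M U \<epsilon> K) \<and>
    (\<exists>!rK. rK \<in> Hom1 A CK M \<and> rK \<odot> FK = r \<and> rK \<rhd> \<kappa> = \<epsilon> \<lhd> r) \<and>
    (\<forall>D K rK. kem_diagram A D \<and> monad_of D = N \<and>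
        (Kl D, KlF D, Kappa D) = (CK, FK, \<kappa>) \<and> (EM D, EMU D, Beta D) = (CE, UE, \<beta>) \<and>
        comparison A CE UE \<beta> M U \<epsilon> K \<and>
        rK \<in> Hom1 A CK M \<and> rK \<odot> FK = r \<and> rK \<rhd> \<kappa> = \<epsilon> \<lhd> r \<longrightarrow>
      (let UK = KlU D; \<epsilon>K = KlCounit D; FE = EMF D; \<epsilon>E = EMCounit D; J = Cmp D;
           is_q = is_coequalizer A CE M (r \<odot> (U \<odot> r) \<odot> UE) (r \<odot> UE)
                    ((r \<odot> UE) \<rhd> \<epsilon>E) (\<epsilon> \<lhd> (r \<odot> UE));
           uK = rK \<rhd> \<epsilon>K
       in
        reflexive_pair A CE M (r \<odot> (U \<odot> r) \<odot> UE) (r \<odot> UE)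
          ((r \<odot> UE) \<rhd> \<epsilon>E) (\<epsilon> \<lhd> (r \<odot> UE)) \<and>
        (\<exists>rE q. is_q rE q) \<and>
        (\<forall>rE q. is_q rE q \<longrightarrow>
          (\<exists>\<eta>' \<epsilon>'. adjunction A CE M rE K \<eta>' \<epsilon>') \<and>
          (\<exists>!v. v \<in> Hom2 A C M (rE \<odot> FE) r \<and> v \<bullet> (q \<lhd> FE) = \<epsilon> \<lhd> r) \<and>
          (\<forall>v. v \<in> Hom2 A C M (rE \<odot> FE) r \<and> v \<bullet> (q \<lhd> FE) = \<epsilon> \<lhd> r \<longrightarrow>
            (\<exists>v' uE. inverse_2cells A C M (rE \<odot> FE) r v v' \<and>
              uE = (rE \<rhd> \<epsilon>E) \<bullet> (v' \<lhd> UE) \<and>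
              (rE \<odot> FE = r \<and> v = Id2 A r \<longrightarrow> uE = rE \<rhd> \<epsilon>E) \<and>
              (\<exists>!w. creates_kem (lax_slice A M) A fst fst (\<lambda>\<tau>. \<tau>)
                  \<lparr>Base = (C, r), Endo = (U \<odot> r, \<epsilon> \<lhd> r), MUnit = \<eta>, Mult = U \<rhd> (\<epsilon> \<lhd> r)\<rparr>
                  D
                  \<lparr>Base = (C, r), Endo = (U \<odot> r, \<epsilon> \<lhd> r), MUnit = \<eta>, Mult = U \<rhd> (\<epsilon> \<lhd> r),
                   Kl = (CK, rK), KlF = (FK, Id2 A r), KlU = (UK, uK),
                   Kappa = \<kappa>, KlCounit = \<epsilon>K,
                   EM = (CE, rE), EMF = (FE, v), EMU = (UE, uE),
                   Beta = \<beta>, EMCounit = \<epsilon>E,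
                   Cmp = (J, w)\<rparr>))))))"
proof -
  interpret two_category A by fact
  interpret op: two_category "op1 A" by (rule op1_two_category)
  note rc = assms(2) and adj = assms(3) and N = assms(4) and kl = assms(5) and em = assms(6)
  have mon: "is_monad A N" unfolding N by (rule adjunction_is_monad[OF adj])
  have r: "r \<in> Hom1 A C M" and U: "U \<in> Hom1 A M C"
    and \<epsilon>: "\<epsilon> \<in> Hom2 A M M (r \<odot> U) (Id1 A M)" using adj by (auto simp: adjunction_def)
  \<comment> \<open>With reversed 1-cells \<open>U\<close> is left adjoint to \<open>r\<close>, and \<open>rK\<close> is the comparison of that adjunction.\<close>
  have ex_rK: "\<exists>!k. comparison (op1 A) CK FK \<kappa> M r \<epsilon> k"
    by (rule op.adjunction_comparison_ex1[of C M U r \<eta> \<epsilon> N])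
      (use adj kl in \<open>simp_all add: op1_em_object N lrwhisk[OF \<epsilon> r U]\<close>)
  show ?thesis
  proof (intro conjI allI impI, goal_cases)
    case 1
    show ?case by (rule kem_diagram_ex1[OF mon kl em])
  next
    case 2
    show ?case by (rule adjunction_comparison_ex1[OF adj em N])
  next
    case 3
    show ?case using ex_rK by (simp add: comparison_def)
  next
    case (4 D K rK)
    interpret adjunction_em A M C CE r U "EMF D" UE \<eta> \<epsilon> \<beta> "EMCounit D"
      by unfold_locales (use 4 adj N in \<open>auto simp: kem_diagram_iff\<close>)
    let ?is_q = "is_coequalizer A CE M (r \<odot> (U \<odot> r) \<odot> UE) (r \<odot> UE)
        ((r \<odot> UE) \<rhd> EMCounit D) (\<epsilon> \<lhd> (r \<odot> UE))"
    let ?creates = "\<lambda>rE v uE. \<exists>!w. creates_kem (lax_slice A M) A fst fst (\<lambda>\<tau>. \<tau>)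
        \<lparr>Base = (C, r), Endo = (U \<odot> r, \<epsilon> \<lhd> r), MUnit = \<eta>, Mult = U \<rhd> (\<epsilon> \<lhd> r)\<rparr>
        D
        \<lparr>Base = (C, r), Endo = (U \<odot> r, \<epsilon> \<lhd> r), MUnit = \<eta>, Mult = U \<rhd> (\<epsilon> \<lhd> r),
         Kl = (CK, rK), KlF = (FK, Id2 A r), KlU = (KlU D, rK \<rhd> KlCounit D),
         Kappa = \<kappa>, KlCounit = KlCounit D,
         EM = (CE, rE), EMF = (EMF D, v), EMU = (UE, uE),
         Beta = \<beta>, EMCounit = EMCounit D,
         Cmp = (Cmp D, w)\<rparr>"
    let ?is_v = "\<lambda>rE q v. v \<in> Hom2 A C M (rE \<odot> EMF D) r \<and> v \<bullet> (q \<lhd> EMF D) = \<epsilon> \<lhd> r"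
    have ex_q: "\<exists>rE q. ?is_q rE q"
      using rc Obj pair_reflexive unfolding rc_0cell_def by blast
    have lift: "(\<exists>\<eta>' \<epsilon>'. adjunction A CE M rE K \<eta>' \<epsilon>') \<and> (\<exists>!v. ?is_v rE q v) \<and>
        (\<forall>v. ?is_v rE q v \<longrightarrow> (\<exists>v' uE. inverse_2cells A C M (rE \<odot> EMF D) r v v' \<and>
          uE = (rE \<rhd> EMCounit D) \<bullet> (v' \<lhd> UE) \<and>
          (rE \<odot> EMF D = r \<and> v = Id2 A r \<longrightarrow> uE = rE \<rhd> EMCounit D) \<and> ?creates rE v uE))"
      if isq: "?is_q rE q" for rE q
    proof -
      interpret kem_lifting A M C CE r U "EMF D" UE \<eta> \<epsilon> \<beta> "EMCounit D" rE q CK FK \<kappa> rK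
        by unfold_locales (use rc isq kl 4 N in auto)
      show ?thesis
      proof (intro conjI allI impI)
        show "\<exists>\<eta>' \<epsilon>'. adjunction A CE M rE K \<eta>' \<epsilon>'" by (rule leg_left_adjoint) (use 4 in blast)
        show "\<exists>!v. ?is_v rE q v" by (rule v_ex1)
        fix v assume v: "?is_v rE q v"
        have inv: "inverse_2cells A C M (rE \<odot> EMF D) r v v_inv" by (rule v_inverse) (use v in auto)
        \<comment> \<open>If \<open>v\<close> is an identity then so is its inverse, and \<open>leg_of_u\<close> loses its correction factor.\<close>
        have q_eq: "q = rE \<rhd> EMCounit D" if "rE \<odot> EMF D = r \<and> v = Id2 A r"
        proof -
          have "v_inv = Id2 A r"
            using inv that VComp_Id_left[of v_inv C M r r] by (simp add: inverse_2cells_def)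
          moreover have "rE \<rhd> EMCounit D \<in> Hom2 A CE M (r \<odot> UE) rE"
            using lwhisk_in[OF e s] that
            by (simp add: Comp1_assoc[OF u F s, symmetric] Comp1_Id_right[OF s])
          ultimately show ?thesis
            using leg_of_u VComp_Id_right by (simp add: rwhisk_Id2[OF u r])
        qed
        have "?creates rE v q" by (rule lifted_kem_diagram) (use 4 v N in auto)
        then show "\<exists>v' uE. inverse_2cells A C M (rE \<odot> EMF D) r v v' \<and>
            uE = (rE \<rhd> EMCounit D) \<bullet> (v' \<lhd> UE) \<and>
            (rE \<odot> EMF D = r \<and> v = Id2 A r \<longrightarrow> uE = rE \<rhd> EMCounit D) \<and> ?creates rE v uE"
          using inv leg_of_u[symmetric] q_eq by blast
      qed
    qed
    show ?case
      unfolding Let_def using pair_reflexive ex_q lift by blast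
  qed
qed

end
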